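(* Let $K$ be an algebraically closed field of characteristic $0$ and let $F,G\in K[x,y]$ satisfy $[F,G]\in K$ and $\{(1,0),(0,1),(0,0)\}\subset N(F)\cap N(G)$. Let $w=(u,v)\in W$ be any direction, let $d=w\text{-}\deg(F_+)$ and $e=w\text{-}\deg(G_+)$, and suppose $d+e-u-v-1\ge 0$. Write the $w$-homogeneous decompositions $F=\sum_{i\le d}F_i$ and $G=\sum_{i\le e}G_i$. Fix a choice of $F_d^{1/d}$. Then there exists a unique sequence of constants $c_0,c_1,\dots,c_{d+e-u-v-1}\in K$ such that $c_0\neq 0$ and $$G_{e-\mu}=\sum_{\gamma=0}^{\mu}c_\gamma\sum\binom{(e-\gamma)/d}{\sum_{\alpha\le d-1}\nu_{\gamma,\alpha}}\frac{\left(\sum_{\alpha\le d-1}\nu_{\gamma,\alpha}\right)!}{\prod_{\alpha\le d-1}\nu_{\gamma,\alpha}!}\,F_d^{(e-\gamma)/d-\sum_{\alpha\le d-1}\nu_{\gamma,\alpha}}\prod_{\alpha\le d-1}F_\alpha^{\nu_{\gamma,\alpha}}$$ for every integer $\mu\in\{0,1,\dots,d+e-u-v-1\}$, where for each $\gamma$ the inner sum runs over all families of non-negative integers $(\nu_{\gamma,\alpha})_{\alpha\le d-1}$ ($\alpha$ ranging over integers) satisfying $\sum_{\alpha\le d-1}(d-\alpha)\nu_{\gamma,\alpha}=\mu-\gamma$. Furthermore, $c_\gamma=0$ if $r(e-\gamma)/d\notin\mathbb{Z}$, where $r\in\mathbb{Z}_{>0}$ is the largest integer such that $F_d^{1/r}\in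 K[x,y]$.
   Context: $[f,g]=\frac{\partial f}{\partial x}\frac{\partial g}{\partial y}-\frac{\partial g}{\partial x}\frac{\partial f}{\partial y}$ is the Jacobian. For $f=\sum f_{ij}x^iy^j$, $\mathrm{supp}(f)=\{(i,j): f_{ij}\ne0\}$ and the Newton polygon $N(f)$ is the convex hull of $\mathrm{supp}(f)$ in $\mathbb{R}^2$. The set of directions is $W=\{(u,v)\in\mathbb{Z}^2: u>0\text{ or }v>0,\ \gcd(|u|,|v|)=1\}$. For $w=(u,v)\in W$, the $w$-degree of the monomial $x^iy^j$ is $ui+vj$; an element of the span of the monomials of $w$-degree $n$ is the homogeneous piece of degree $n$ (so $F_i$ denotes the $w$-homogeneous component of $F$ of $w$-degree $i$, possibly zero, $i\in\mathbb Z$). $P_+$ denotes the $w$-leading form of a nonzero polynomial $P$, i.e. its nonzero homogeneous component of highest $w$-degree, and $w\text{-}\deg(P)=w\text{-}\deg(P_+)$. For real $A$ and a nonnegative integer $B$, $\binom{A}{B}=\frac{A(A-1)\cdots(A-B+1)}{B!}$. Fractional powers: one fixes a $d$-th root $F_d^{1/d}$ of $F_d$ (in an algebraic closure of $K(x,y)$) and sets $F_d^{c/d}:=(F_d^{1/d})^c$ for every integer $c$; the formula is an identity in the ring $K[x,y][F_d^{\pm1/d}]$. The condition $F_d^{1/r}\in K[x,y]$ means that $F_d$ is an $r$-th power in $K[x,y]$. (The assumption on Newton polygons implies $d>0$ and $e>0$.) *)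

theory Defs
  imports
    "HOL-Algebra.Algebraic_Closure_Type"
    "HOL-Computational_Algebra.Computational_Algebra"
    "HOL-Analysis.Convex"
begin

text \<open>
  The ring \<open>K[x,y]\<close> is represented as \<open>K[x][y]\<close>: the coefficient of \<open>x\<^sup>i y\<^sup>j\<close>
  in \<open>P\<close> is the \<open>i\<close>-th coefficient of the \<open>j\<close>-th coefficient of \<open>P\<close>.
\<close>

definition coeff2 :: "'k::zero poly poly \<Rightarrow> nat \<times> nat \<Rightarrow> 'k" where
  "coeff2 P = (\<lambda>(i, j). Polynomial.coeff (Polynomial.coeff P j) i)"

definition monom2 :: "'k::zero \<Rightarrow> nat \<times> nat \<Rightarrow> 'k poly poly" where
  "monom2 a = (\<lambda>(i, j). Polynomial.monom (Polynomial.monom a i) j)"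

definition const2 :: "'k::zero \<Rightarrow> 'k poly poly" where
  "const2 a = [:[:a:]:]"

definition deriv_x :: "'k::field poly poly \<Rightarrow> 'k poly poly" where
  "deriv_x P = map_poly pderiv P"

definition deriv_y :: "'k::field poly poly \<Rightarrow> 'k poly poly" where
  "deriv_y P = pderiv P"

definition jacobian :: "'k::field poly poly \<Rightarrow> 'k poly poly \<Rightarrow> 'k poly poly" where
  "jacobian F G = deriv_x F * deriv_y G - deriv_x G * deriv_y F"

definition supp :: "'k::zero poly poly \<Rightarrow> (nat \<times> nat) set" where
  "supp P = {m. coeff2 P m \<noteq> 0}"

definition newton_polygon :: "'k::zero poly poly \<Rightarrow> (real \<times> real) set" where
  "newton_polygon P = convex hull ((\<lambda>(i, j). (real i, real j)) ` supp P)"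

definition directions :: "(int \<times> int) set" where
  "directions = {(u, v). (u > 0 \<or> v > 0) \<and> gcd \<bar>u\<bar> \<bar>v\<bar> = 1}"

definition mon_deg :: "int \<times> int \<Rightarrow> nat \<times> nat \<Rightarrow> int" where
  "mon_deg w m = fst w * int (fst m) + snd w * int (snd m)"

definition hom_part :: "int \<times> int \<Rightarrow> int \<Rightarrow> 'k::comm_monoid_add poly poly \<Rightarrow> 'k poly poly" where
  "hom_part w n P = (\<Sum>m | m \<in> supp P \<and> mon_deg w m = n. monom2 (coeff2 P m) m)"

text \<open>Only meaningful for \<open>P \<noteq> 0\<close>; likewise for \<open>lead_form\<close>.\<close>

definition wdeg :: "int \<times> int \<Rightarrow> 'k::zero poly poly \<Rightarrow> int" where
  "wdeg w P = Max (mon_deg w ` supp P)"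

definition lead_form :: "int \<times> int \<Rightarrow> 'k::comm_monoid_add poly poly \<Rightarrow> 'k poly poly" where
  "lead_form w P = hom_part w (wdeg w P) P"

text \<open>
  The largest \<open>r > 0\<close> such that \<open>P\<close> is an \<open>r\<close>-th power in \<open>K[x,y]\<close>.
  It exists whenever \<open>P\<close> is not constant.
\<close>

definition max_power_exponent :: "'k::field poly poly \<Rightarrow> nat" where
  "max_power_exponent P = (GREATEST r. r > 0 \<and> is_nth_power r P)"

text \<open>The embedding of \<open>K[x,y]\<close> into an algebraic closure of its fraction field \<open>K(x,y)\<close>.\<close>

definition emb :: "'k::field poly poly \<Rightarrow> 'k poly poly fract alg_closure" where
  "emb P = to_ac (to_fract P)"

text \<open>
  The families \<open>(\<nu>\<^sub>\<alpha>)\<close> of non-negative integers indexed by the integers \<open>\<alpha> \<le> d - 1\<close> with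
  \<open>\<Sum>(d - \<alpha>) \<nu>\<^sub>\<alpha> = n\<close>, extended by zero to all integers \<open>\<alpha>\<close>. Finite support is no
  extra restriction, because the weights \<open>d - \<alpha>\<close> are at least 1.
\<close>

definition families :: "int \<Rightarrow> int \<Rightarrow> (int \<Rightarrow> nat) set" where
  "families d n = {\<nu>. finite {\<alpha>. \<nu> \<alpha> \<noteq> 0} \<and> (\<forall>\<alpha>. \<nu> \<alpha> \<noteq> 0 \<longrightarrow> \<alpha> \<le> d - 1) \<and>
                      (\<Sum>\<alpha> | \<nu> \<alpha> \<noteq> 0. (d - \<alpha>) * int (\<nu> \<alpha>)) = n}"

lemma finite_families: "finite (families d n)"
proof -
  have "families d n \<subseteq> {\<nu>. \<forall>\<alpha>. (\<alpha> \<in> {d - n..d - 1} \<longrightarrow> \<nu> \<alpha> \<in> {..nat n}) \<and>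
                                  (\<alpha> \<notin> {d - n..d - 1} \<longrightarrow> \<nu> \<alpha> = 0)}" (is "_ \<subseteq> ?B")
  proof
    fix \<nu> assume "\<nu> \<in> families d n"
    then have fin: "finite {\<alpha>. \<nu> \<alpha> \<noteq> 0}" and le: "\<And>\<alpha>. \<nu> \<alpha> \<noteq> 0 \<Longrightarrow> \<alpha> \<le> d - 1"
      and eq: "(\<Sum>\<alpha> | \<nu> \<alpha> \<noteq> 0. (d - \<alpha>) * int (\<nu> \<alpha>)) = n"
      by (auto simp: families_def)
    have "\<alpha> \<in> {d - n..d - 1} \<and> \<nu> \<alpha> \<in> {..nat n}" if a: "\<nu> \<alpha> \<noteq> 0" for \<alpha>
    proof -
      have "(d - \<alpha>) * int (\<nu> \<alpha>) \<le> (\<Sum>\<alpha> | \<nu> \<alpha> \<noteq> 0. (d - \<alpha>) * int (\<nu> \<alpha>))"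
      proof (rule member_le_sum)
        show "0 \<le> (d - x) * int (\<nu> x)" if "x \<in> {\<alpha>. \<nu> \<alpha> \<noteq> 0} - {\<alpha>}" for x
          using that le[of x] by simp
      qed (use a fin in auto)
      then have *: "(d - \<alpha>) * int (\<nu> \<alpha>) \<le> n" using eq by simp
      have "(d - \<alpha>) * 1 \<le> (d - \<alpha>) * int (\<nu> \<alpha>)"
        using a le[OF a] by (intro mult_left_mono) simp_all
      from this * have "(d - \<alpha>) * 1 \<le> n" by (rule order_trans)
      moreover have "1 * int (\<nu> \<alpha>) \<le> (d - \<alpha>) * int (\<nu> \<alpha>)"
        using a le[OF a] by (intro mult_right_mono) simp_all
      from this * have "1 * int (\<nu> \<alpha>) \<le> n" by (rule order_trans)
      ultimately show ?thesis using le[OF a] by simp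
    qed
    moreover have "\<nu> \<alpha> \<in> {..nat n}" if "\<nu> \<alpha> = 0" for \<alpha> using that by simp
    ultimately show "\<nu> \<in> ?B" by blast
  qed
  moreover have "finite ?B" by (rule finite_set_of_finite_funs) auto
  ultimately show ?thesis by (rule finite_subset)
qed

text \<open>
  The right-hand side of the formula for \<open>G\<^bsub>e-\<mu>\<^esub>\<close>. Here \<open>d\<close> is the \<open>w\<close>-degree of \<open>F\<close> and \<open>\<rho>\<close> is
  the chosen \<open>d\<close>-th root of the leading form of \<open>F\<close>, so that the power with exponent
  \<open>(e - \<gamma>) / d - N\<close> of the latter is \<open>\<rho>\<close> to the integer \<open>e - \<gamma> - d N\<close>.
  The rational binomial and multinomial coefficients are computed in \<open>K\<close>, which contains the rationals.
\<close>

definition magnus_rhs ::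
  "int \<times> int \<Rightarrow> 'k::field_char_0 poly poly \<Rightarrow> int \<Rightarrow> int \<Rightarrow> 'k poly poly fract alg_closure \<Rightarrow>
   (int \<Rightarrow> 'k) \<Rightarrow> int \<Rightarrow> 'k poly poly fract alg_closure" where
  "magnus_rhs w F d e \<rho> c \<mu> =
     (\<Sum>\<gamma> = 0..\<mu>. emb (const2 (c \<gamma>)) *
       (\<Sum>\<nu> \<in> families d (\<mu> - \<gamma>).
          let N = (\<Sum>\<alpha> | \<nu> \<alpha> \<noteq> 0. \<nu> \<alpha>) in
          emb (const2 (((of_int (e - \<gamma>) / of_int d) gchoose N) *
                       (fact N / (\<Prod>\<alpha> | \<nu> \<alpha> \<noteq> 0. fact (\<nu> \<alpha>))))) *
          \<rho> powi (e - \<gamma> - d * int N) *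
          (\<Prod>\<alpha> | \<nu> \<alpha> \<noteq> 0. emb (hom_part w \<alpha> F) ^ \<nu> \<alpha>)))"

end

theory Submission
  imports
    Defs
    "HOL-Combinatorics.Multiset_Permutations"
    "Berlekamp_Zassenhaus.Unique_Factorization_Poly"
begin

no_notation vec_index (infixl \<open>$\<close> 100)

text \<open>
  Adjoin a variable \<open>t\<close> and put \<open>\<Phi> = \<Sum> F\<^bsub>d-n\<^esub> t\<^sup>n = F\<^sub>d (1 + S)\<close> and \<open>\<Gamma> = \<Sum> G\<^bsub>e-n\<^esub> t\<^sup>n\<close>. Extended
  coefficientwise, the Jacobian \<open>[\<Phi>, \<Gamma>]\<close> has as coefficients the \<open>w\<close>-homogeneous parts of \<open>[F, G]\<close>, so it
  vanishes below \<open>t\<close> to the power \<open>d + e - u - v\<close>. The powers \<open>\<Phi>\<^bsup>s\<^esup>\<close> with rational \<open>s\<close> have zero Jacobian with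
  \<open>\<Phi>\<close>. After subtracting from \<open>\<Gamma>\<close> a suitable combination \<open>\<Sum> c\<^sub>\<gamma> t\<^sup>\<gamma> \<Phi>\<^bsup>(e-\<gamma>)/d\<^esup>\<close> over \<open>\<gamma> < \<mu>\<close>, the
  remaining lowest coefficient \<open>h\<^sub>\<mu>\<close> is therefore homogeneous of degree \<open>e - \<mu>\<close> with \<open>[F\<^sub>d, h\<^sub>\<mu>] = 0\<close>, and
  Euler's relation forces \<open>h\<^sub>\<mu>\<close> to be a constant multiple of the power of \<open>F\<^sub>d\<close> with exponent \<open>(e - \<mu>) / d\<close>.

  All \<open>h\<^sub>\<mu>\<close> lie in \<open>K(x,y)\<close>, so no derivation of the algebraic closure is needed: the
  quotient of \<open>h\<^sub>\<mu>\<^sup>d\<close> by \<open>F\<^sub>d\<close> to the power \<open>e - \<mu>\<close> is a rational function killed by both partial derivatives.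
  If \<open>c\<^sub>\<mu> \<noteq> 0\<close>, then \<open>F\<^sub>d\<close> to the power \<open>e - \<mu>\<close> is a \<open>d\<close>-th power in \<open>K(x,y)\<close>, and unique factorization in
  \<open>K[x,y]\<close> bounds the denominator of \<open>(e - \<mu>) / d\<close> by the maximality of \<open>r\<close>.
\<close>


section \<open>Derivations of fields of fractions and of power series\<close>

locale derivation =
  fixes D :: "'a::comm_ring_1 \<Rightarrow> 'a"
  assumes add: "D (a + b) = D a + D b"
    and mult: "D (a * b) = D a * b + a * D b"
begin

lemma zero [simp]: "D 0 = 0"
  using add[of 0 0] by simp

lemma one [simp]: "D 1 = 0"
  using mult[of 1 1] by simp

lemma uminus: "D (- a) = - D a"
  using add[of a "- a"] by (simp add: eq_neg_iff_add_eq_0 add.commute)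

lemma diff: "D (a - b) = D a - D b"
  using add[of a "- b"] by (simp add: uminus)

lemma sum: "D (\<Sum>i\<in>I. f i) = (\<Sum>i\<in>I. D (f i))"
  by (induction I rule: infinite_finite_induct) (simp_all add: add)

lemma of_nat [simp]: "D (of_nat n) = 0"
  by (induction n) (simp_all add: add)

lemma of_int [simp]: "D (of_int n) = 0"
  by (cases n) (simp_all add: uminus diff)

lemma power: "D (a ^ n) = of_nat n * a ^ (n - 1) * D a"
proof (induction n)
  case (Suc n)
  then show ?case
    by (cases n) (simp_all add: mult algebra_simps)
qed simp

text \<open>Supplies the Euler derivation, a combination of the two partial derivatives, both on
  \<open>K[x,y]\<close> and on \<open>K(x,y)\<close>.\<close>

lemma linear_combination:
  assumes "derivation D'"
  shows "derivation (\<lambda>z. a * D z + b * D' z)"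
proof -
  interpret D': derivation D' by fact
  show ?thesis
    by standard (simp_all add: add mult D'.add D'.mult algebra_simps)
qed

end

context
  fixes D :: "'a::field \<Rightarrow> 'a"
  assumes D: "derivation D"
begin

interpretation derivation D by (fact D)

lemma derivation_divide:
  assumes "b \<noteq> 0"
  shows "D (a / b) = (D a * b - a * D b) / b ^ 2"
proof -
  have "D a = D (a / b) * b + a / b * D b"
    using mult[of "a / b" b] assms by simp
  then show ?thesis
    using assms by (simp add: field_simps power2_eq_square)
qed

text \<open>The extra factor \<open>a\<close> keeps the exponent \<open>n\<close> on both sides, so
  that nonnegative and negative powers obey one formula.\<close>

lemma derivation_power_int:
  assumes "a \<noteq> 0"
  shows "a * D (a powi n) = of_int n * a powi n * D a"
proof -
  have pow: "a * D (a ^ k) = of_nat k * a ^ k * D a" for k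
    unfolding power by (cases k) simp_all
  show ?thesis
  proof (cases n rule: int_cases2)
    case (nonneg k)
    then show ?thesis using pow[of k] by simp
  next
    case (nonpos k)
    have "a * D (1 / a ^ k) = - (a * D (a ^ k)) / (a ^ k)\<^sup>2"
      using assms by (subst derivation_divide) simp_all
    also have "\<dots> = - of_nat k * (1 / a ^ k) * D a"
      using assms by (simp add: pow power2_eq_square field_simps)
    finally show ?thesis
      using nonpos assms by (simp add: power_int_minus field_simps)
  qed
qed

lemma derivation_of_rat_quotient [simp]: "D (of_int m / of_int n) = 0"
  by (cases "of_int n = (0 :: 'a)") (simp_all add: derivation_divide)

end

section \<open>Extension of a derivation to the field of fractions\<close>

definition fract_deriv :: "('a::idom \<Rightarrow> 'a) \<Rightarrow> 'a fract \<Rightarrow> 'a fract" where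
  "fract_deriv D z = (THE t. \<forall>a b. b \<noteq> 0 \<longrightarrow> z = Fraction_Field.Fract a b \<longrightarrow>
     t = Fraction_Field.Fract (D a * b - a * D b) (b ^ 2))"

text \<open>\<open>THE\<close> in the definition ranges over all representations of the fraction, so
  the quotient rule holds for a given one once every other is shown to give the same value.\<close>

lemma fract_deriv_Fract:
  assumes "derivation D" "b \<noteq> 0"
  shows "fract_deriv D (Fraction_Field.Fract a b) = Fraction_Field.Fract (D a * b - a * D b) (b ^ 2)"
proof -
  interpret derivation D by fact
  have "Fraction_Field.Fract (D a * b - a * D b) (b ^ 2) = Fraction_Field.Fract (D a' * b' - a' * D b') (b' ^ 2)"
    if nz: "b' \<noteq> 0" and eq: "Fraction_Field.Fract a b = Fraction_Field.Fract a' b'" for a' b'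
  proof -
    have e: "a * b' = a' * b"
      using nz eq assms(2) by (simp add: eq_fract)
    then have "D a * b' + a * D b' = D a' * b + a' * D b"
      using mult by metis
    then have "b * b' * (D a * b' + a * D b') = b * b' * (D a' * b + a' * D b)"
      by simp
    moreover have "a * b' * (D b' * b + b' * D b) = a' * b * (D b' * b + b' * D b)"
      using e by simp
    \<comment> \<open>The cross-multiplied difference combines two differences that vanish:
      \<open>b * b'\<close> times the differentiated relation \<open>a * b' = a' * b\<close>, and
      that relation itself times \<open>D (b * b')\<close>.\<close>
    moreover have "(D a * b - a * D b) * b' ^ 2 - (D a' * b' - a' * D b') * b ^ 2
        = (b * b' * (D a * b' + a * D b') - b * b' * (D a' * b + a' * D b))
          - (a * b' * (D b' * b + b' * D b) - a' * b * (D b' * b + b' * D b))"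
      by (simp add: power2_eq_square algebra_simps)
    ultimately have "(D a * b - a * D b) * b' ^ 2 = (D a' * b' - a' * D b') * b ^ 2"
      by (metis diff_self right_minus_eq)
    then show ?thesis
      using nz assms(2) by (simp add: eq_fract)
  qed
  then show ?thesis
    unfolding fract_deriv_def using assms(2) by (intro the_equality) blast+
qed

lemma fract_deriv_to_fract:
  assumes "derivation D"
  shows "fract_deriv D (to_fract a) = to_fract (D a)"
  using assms by (simp add: to_fract_def fract_deriv_Fract derivation.one)

lemma derivation_fract_deriv:
  assumes "derivation D"
  shows "derivation (fract_deriv D)"
proof -
  interpret derivation D by fact
  show ?thesis
  proof
    fix y z :: "'a fract"
    obtain a b where y: "y = Fraction_Field.Fract a b" "b \<noteq> 0" by (cases y)
    obtain c d where z: "z = Fraction_Field.Fract c d" "d \<noteq> 0" by (cases z)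
    show "fract_deriv D (y + z) = fract_deriv D y + fract_deriv D z"
      using y z assms
      by (simp add: fract_deriv_Fract eq_fract mult add) (simp add: algebra_simps power2_eq_square)
    show "fract_deriv D (y * z) = fract_deriv D y * z + y * fract_deriv D z"
      using y z assms
      by (simp add: fract_deriv_Fract eq_fract mult add) (simp add: algebra_simps power2_eq_square)
  qed
qed

section \<open>Coefficientwise derivations of power series\<close>

definition fps_coeffwise :: "('a \<Rightarrow> 'a) \<Rightarrow> 'a fps \<Rightarrow> 'a fps" where
  "fps_coeffwise D A = Abs_fps (\<lambda>n. D (A $ n))"

lemma fps_coeffwise_nth [simp]: "fps_coeffwise D A $ n = D (A $ n)"
  by (simp add: fps_coeffwise_def)

lemma derivation_fps_coeffwise:
  assumes "derivation D"
  shows "derivation (fps_coeffwise D)"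
proof -
  interpret derivation D by fact
  show ?thesis
    by standard (simp_all add: fps_eq_iff add fps_mult_nth sum mult sum.distrib)
qed

lemma fps_coeffwise_const [simp]:
  assumes "derivation D"
  shows "fps_coeffwise D (fps_const a) = fps_const (D a)"
  using derivation.zero[OF assms] by (simp add: fps_eq_iff)

lemma fps_coeffwise_X_power [simp]:
  assumes "derivation D"
  shows "fps_coeffwise D (fps_X ^ n) = 0"
  using derivation.zero[OF assms] derivation.one[OF assms] by (simp add: fps_eq_iff)

text \<open>Chain rule for a derivation that acts on coefficients but not on the formal variable:
  since \<open>D\<close> kills the coefficients of \<open>R\<close>, only the powers of
  \<open>S\<close> are differentiated.\<close>

lemma fps_coeffwise_compose:
  fixes R S :: "'a::field fps"
  assumes "derivation D" and S0: "S $ 0 = 0" and R: "\<And>n. D (R $ n) = 0"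
  shows "fps_coeffwise D (R oo S) = (fps_deriv R oo S) * fps_coeffwise D S"
proof (rule fps_ext)
  fix n
  interpret derivation D by fact
  interpret C: derivation "fps_coeffwise D" by (rule derivation_fps_coeffwise) fact
  let ?T = "fps_coeffwise D S"
  have "fps_coeffwise D (R oo S) $ n = (\<Sum>i=0..n. R $ i * fps_coeffwise D (S ^ i) $ n)"
    by (simp add: fps_compose_nth sum mult R)
  also have "\<dots> = (\<Sum>i=0..n. of_nat i * R $ i * (S ^ (i - 1) * ?T) $ n)"
    by (simp add: C.power mult_ac fps_mult_of_nat_nth)
  also have "\<dots> = (\<Sum>i=1..n. of_nat i * R $ i * (S ^ (i - 1) * ?T) $ n)"
    by (simp add: sum.atLeast_Suc_atMost)
  also have "\<dots> = (\<Sum>i<n. fps_deriv R $ i * (S ^ i * ?T) $ n)"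
    by (rule sum.reindex_bij_witness[of _ "\<lambda>i. i + 1" "\<lambda>i. i - 1"]) auto
  \<comment> \<open>The added term \<open>i = n\<close> vanishes: \<open>S ^ n\<close> has no
    coefficients below \<open>n\<close>, and its coefficient at \<open>n\<close> meets
    \<open>D (S $ 0) = 0\<close>.\<close>
  also have "\<dots> = (\<Sum>i=0..n. fps_deriv R $ i * (S ^ i * ?T) $ n)"
  proof (rule sum.mono_neutral_left; (intro ballI)?)
    fix i assume "i \<in> {0..n} - {..<n}"
    then have "i = n" by auto
    have "(S ^ n * ?T) $ n = (\<Sum>j=0..n. (S ^ n) $ j * D (S $ (n - j)))"
      by (simp add: fps_mult_nth)
    also have "\<dots> = 0"
    proof (rule sum.neutral, intro ballI)
      fix j assume "j \<in> {0..n}"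
      then show "(S ^ n) $ j * D (S $ (n - j)) = 0"
        using S0 startsby_zero_power_prefix[OF S0, of n] by (cases "j = n") auto
    qed
    finally show "fps_deriv R $ i * (S ^ i * ?T) $ n = 0"
      using \<open>i = n\<close> by simp
  qed auto
  also have "\<dots> = (\<Sum>i=0..n. \<Sum>j=0..n. fps_deriv R $ i * ((S ^ i) $ j * ?T $ (n - j)))"
    by (simp add: fps_mult_nth sum_distrib_left)
  also have "\<dots> = (\<Sum>j=0..n. \<Sum>i=0..n. fps_deriv R $ i * ((S ^ i) $ j * ?T $ (n - j)))"
    by (rule sum.swap)
  also have "\<dots> = (\<Sum>j=0..n. \<Sum>i=0..j. fps_deriv R $ i * ((S ^ i) $ j * ?T $ (n - j)))"
  proof (rule sum.cong[OF refl])
    fix j assume "j \<in> {0..n}"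
    then show "(\<Sum>i=0..n. fps_deriv R $ i * ((S ^ i) $ j * ?T $ (n - j)))
             = (\<Sum>i=0..j. fps_deriv R $ i * ((S ^ i) $ j * ?T $ (n - j)))"
      using startsby_zero_power_prefix[OF S0]
      by (intro sum.mono_neutral_right) auto
  qed
  also have "\<dots> = ((fps_deriv R oo S) * ?T) $ n"
    unfolding fps_mult_nth fps_compose_nth sum_distrib_right by (simp add: mult.assoc)
  finally show "fps_coeffwise D (R oo S) $ n = ((fps_deriv R oo S) * ?T) $ n" .
qed

instance fract :: ("{idom,ring_char_0}") ring_char_0
proof
  have "of_nat n = to_fract (of_nat n :: 'a)" for n
    by (induction n) simp_all
  then show "inj (of_nat :: nat \<Rightarrow> 'a fract)"
    by (intro injI) simp
qed

instance fract :: ("{idom,ring_char_0}") field_char_0 ..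


section \<open>Homogeneous components and the Euler derivation\<close>

lemma derivation_pderiv: "derivation (pderiv :: 'a::idom poly \<Rightarrow> _)"
  by standard (simp_all add: pderiv_add pderiv_mult algebra_simps)

lemma derivation_deriv_y: "derivation deriv_y"
  by standard (simp_all add: deriv_y_def pderiv_add pderiv_mult algebra_simps)

lemma coeff_deriv_x [simp]: "Polynomial.coeff (deriv_x P) j = pderiv (Polynomial.coeff P j)"
  by (simp add: deriv_x_def coeff_map_poly)

lemma derivation_deriv_x: "derivation deriv_x"
proof
  fix P Q :: "'a poly poly"
  interpret p: derivation "pderiv :: 'a poly \<Rightarrow> _" by (rule derivation_pderiv)
  show "deriv_x (P + Q) = deriv_x P + deriv_x Q"
    by (rule poly_eqI) (simp add: pderiv_add)
  show "deriv_x (P * Q) = deriv_x P * Q + P * deriv_x Q"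
    by (rule poly_eqI)
       (simp add: coeff_mult p.sum p.mult sum.distrib)
qed

lemma deriv_x_deriv_y: "deriv_x (deriv_y P) = deriv_y (deriv_x P)"
proof (rule poly_eqI)
  fix n
  have "pderiv (of_nat k * p) = of_nat k * pderiv p" for k and p :: "'a poly"
    by (simp add: pderiv_mult)
  from this[of "Suc n"]
  show "Polynomial.coeff (deriv_x (deriv_y P)) n = Polynomial.coeff (deriv_y (deriv_x P)) n"
    by (simp add: deriv_y_def coeff_pderiv del: of_nat_Suc)
qed

section \<open>Coefficients of polynomials in two variables\<close>

lemma poly2_eqI: "(\<And>m. coeff2 P m = coeff2 Q m) \<Longrightarrow> P = Q"
  by (auto simp: coeff2_def intro!: poly_eqI)

lemma coeff2_0 [simp]: "coeff2 0 m = 0"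
  by (simp add: coeff2_def split: prod.splits)

lemma coeff2_add: "coeff2 (P + Q) m = coeff2 P m + coeff2 Q m"
  by (simp add: coeff2_def split: prod.splits)

lemma coeff2_sum: "coeff2 (\<Sum>i\<in>I. f i) m = (\<Sum>i\<in>I. coeff2 (f i) m)"
  by (induction I rule: infinite_finite_induct) (simp_all add: coeff2_add)

lemma coeff2_monom2: "coeff2 (monom2 a m) m' = (if m = m' then a else 0)"
  by (auto simp: coeff2_def monom2_def split: prod.splits)

lemma const2_0 [simp]: "const2 0 = 0"
  and const2_1 [simp]: "const2 1 = 1"
  by (simp_all add: const2_def)

lemma const2_add: "const2 (a + b) = const2 a + const2 b"
  and const2_mult: "const2 (a * b) = const2 a * const2 b"
  by (simp_all add: const2_def)

lemma const2_of_int: "const2 (of_int k :: 'k::field) = of_int k"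
  by (simp add: const2_def of_int_poly)

lemma coeff2_const2: "coeff2 (const2 a) m = (if m = (0, 0) then a else 0)"
  by (auto simp: coeff2_def const2_def coeff_pCons split: prod.splits nat.splits)

lemma coeff2_const2_mult: "coeff2 (const2 a * P) m = a * coeff2 P m"
  by (simp add: coeff2_def const2_def split: prod.splits)

lemma finite_supp: "finite (supp P)"
proof (rule finite_subset)
  let ?A = "SIGMA j:{..Polynomial.degree P}. {..Polynomial.degree (Polynomial.coeff P j)}"
  show "supp P \<subseteq> (\<lambda>(j, i). (i, j)) ` ?A"
  proof
    fix m assume "m \<in> supp P"
    then obtain i j where m: "m = (i, j)" "Polynomial.coeff (Polynomial.coeff P j) i \<noteq> 0"
      by (cases m) (auto simp: supp_def coeff2_def)
    then have "i \<le> Polynomial.degree (Polynomial.coeff P j)" "j \<le> Polynomial.degree P"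
      by (auto intro!: Polynomial.le_degree)
    then show "m \<in> (\<lambda>(j, i). (i, j)) ` ?A"
      unfolding m(1) by (intro image_eqI[of _ _ "(j, i)"]) auto
  qed
qed simp

text \<open>The weighted Euler operator. In characteristic 0 its eigenspaces for integers are the
  homogeneous pieces, so homogeneity becomes a differential equation that still makes sense for
  rational functions.\<close>

definition euler :: "int \<times> int \<Rightarrow> 'k::field poly poly \<Rightarrow> 'k poly poly" where
  "euler w P = of_int (fst w) * [:[:0, 1:]:] * deriv_x P + of_int (snd w) * [:0, 1:] * deriv_y P"

lemma coeff2_euler: "coeff2 (euler w P) m = of_int (mon_deg w m) * coeff2 P m"
proof -
  obtain i j where m: "m = (i, j)" by force
  have const: "of_int k * R = const2 (of_int k) * R" for k and R :: "'a poly poly"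
    by (simp add: const2_of_int)
  have x: "coeff2 ([:[:0, 1:]:] * deriv_x P) m = of_nat i * coeff2 P m"
    by (cases i) (simp_all add: coeff2_def m coeff_pCons coeff_pderiv)
  have y: "coeff2 ([:0, 1:] * deriv_y P) m = of_nat j * coeff2 P m"
    by (cases j) (simp_all add: coeff2_def m coeff_pCons coeff_pderiv deriv_y_def
        of_nat_poly flip: of_nat_Suc)
  show ?thesis
    unfolding euler_def mult.assoc coeff2_add const coeff2_const2_mult x y
    by (simp add: mon_deg_def m algebra_simps)
qed

lemma euler_eq_iff:
  fixes P :: "'k::field_char_0 poly poly"
  shows "euler w P = of_int n * P \<longleftrightarrow> (\<forall>m. coeff2 P m \<noteq> 0 \<longrightarrow> mon_deg w m = n)"
proof -
  have "euler w P = of_int n * P \<longleftrightarrow> (\<forall>m. coeff2 (euler w P) m = coeff2 (const2 (of_int n) * P) m)"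
    by (metis const2_of_int poly2_eqI)
  then show ?thesis
    by (auto simp: coeff2_euler coeff2_const2_mult)
qed

lemma derivation_euler: "derivation (euler w)"
  unfolding euler_def
  by (rule derivation.linear_combination[OF derivation_deriv_x derivation_deriv_y])

lemma coeff2_hom_part: "coeff2 (hom_part w n P) m = (if mon_deg w m = n then coeff2 P m else 0)"
proof -
  have "coeff2 (hom_part w n P) m
      = (\<Sum>m' | m' \<in> supp P \<and> mon_deg w m' = n. if m' = m then coeff2 P m' else 0)"
    by (simp add: hom_part_def coeff2_sum coeff2_monom2)
  also have "\<dots> = (if m \<in> supp P \<and> mon_deg w m = n then coeff2 P m else 0)"
    using finite_supp[of P] by (subst sum.delta) auto
  finally show ?thesis
    by (auto simp: supp_def)
qed

lemma euler_hom_part: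
  "euler w (hom_part w n P) = of_int n * hom_part w n (P :: 'k::field_char_0 poly poly)"
  unfolding euler_eq_iff by (simp add: coeff2_hom_part)

text \<open>Differentiating in \<open>x\<close> lowers the \<open>w\<close>-degree by
  \<open>u\<close>, expressed here as a commutator relation; the correction comes from
  differentiating the factor \<open>x\<close> in \<open>euler\<close>.\<close>

lemma euler_deriv_x: "euler w (deriv_x P) = deriv_x (euler w P) - of_int (fst w) * deriv_x P"
proof -
  interpret X: derivation deriv_x by (rule derivation_deriv_x)
  define x y :: "'a poly poly" where "x = [:[:0, 1:]:]" and "y = [:0, 1:]"
  have "deriv_x x = 1" "deriv_x y = 0"
    unfolding x_def y_def
    by (rule poly_eqI; simp add: coeff_pCons pderiv_pCons split: nat.splits)+
  then show ?thesis
    unfolding euler_def x_def[symmetric] y_def[symmetric]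
    by (simp add: X.add X.mult deriv_x_deriv_y algebra_simps)
qed

lemma euler_deriv_y: "euler w (deriv_y P) = deriv_y (euler w P) - of_int (snd w) * deriv_y P"
proof -
  interpret Y: derivation deriv_y by (rule derivation_deriv_y)
  define x y :: "'a poly poly" where "x = [:[:0, 1:]:]" and "y = [:0, 1:]"
  have "deriv_y x = 0" "deriv_y y = 1"
    unfolding x_def y_def
    by (simp_all add: deriv_y_def pderiv_pCons)
  then show ?thesis
    unfolding euler_def x_def[symmetric] y_def[symmetric]
    by (simp add: Y.add Y.mult deriv_x_deriv_y algebra_simps)
qed

lemma euler_jacobian:
  assumes "euler w P = of_int a * P" "euler w Q = of_int b * Q"
  shows "euler w (jacobian P Q) = of_int (a + b - fst w - snd w) * jacobian P Q"
proof -
  interpret E: derivation "euler w" by (rule derivation_euler)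
  interpret X: derivation deriv_x by (rule derivation_deriv_x)
  interpret Y: derivation deriv_y by (rule derivation_deriv_y)
  show ?thesis
    unfolding jacobian_def E.diff E.mult euler_deriv_x euler_deriv_y assms
    by (simp add: X.mult Y.mult algebra_simps)
qed

section \<open>Homogeneous parts of a constant Jacobian\<close>

lemma hom_part_sum:
  assumes "\<And>m. m \<in> supp P \<Longrightarrow> mon_deg w m \<in> {a - int N..a}"
  shows "(\<Sum>i\<le>N. hom_part w (a - int i) P) = P"
proof (rule poly2_eqI)
  fix m
  have "coeff2 (\<Sum>i\<le>N. hom_part w (a - int i) P) m
      = (\<Sum>i\<le>N. if mon_deg w m = a - int i then coeff2 P m else 0)"
    by (simp add: coeff2_sum coeff2_hom_part)
  also have "\<dots> = coeff2 P m"
  proof (cases "m \<in> supp P")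
    case True
    then have "mon_deg w m = a - int i \<longleftrightarrow> i = nat (a - mon_deg w m)" for i
      using assms[of m] by auto
    moreover have "nat (a - mon_deg w m) \<le> N"
      using assms[OF True] by auto
    ultimately show ?thesis
      by simp
  next
    case False
    then show ?thesis
      by (intro trans[OF sum.neutral]) (auto simp: supp_def)
  qed
  finally show "coeff2 (\<Sum>i\<le>N. hom_part w (a - int i) P) m = coeff2 P m" .
qed

lemma jacobian_sum:
  "jacobian (\<Sum>i\<in>I. f i) (\<Sum>j\<in>J. g j) = (\<Sum>i\<in>I. \<Sum>j\<in>J. jacobian (f i) (g j))"
proof -
  interpret X: derivation deriv_x by (rule derivation_deriv_x)
  interpret Y: derivation deriv_y by (rule derivation_deriv_y)
  show ?thesis
    unfolding jacobian_def X.sum Y.sum sum_product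
    by (subst (2) sum.swap) (simp add: sum_subtractf)
qed

lemma supp_mon_deg_le_wdeg: "m \<in> supp P \<Longrightarrow> mon_deg w m \<le> wdeg w P"
  unfolding wdeg_def by (intro Max_ge) (auto simp: finite_supp)

text \<open>The sum is the homogeneous part of \<open>[F, G]\<close> of \<open>w\<close>-degree
  \<open>d + e - k - u - v\<close>. A constant lives only in degree 0, and the condition on
  \<open>k\<close> excludes that degree.\<close>

lemma sum_jacobian_hom_parts_eq_0:
  fixes F G :: "'k::field_char_0 poly poly"
  assumes const: "jacobian F G \<in> range const2"
    and d: "d = wdeg w F" and e: "e = wdeg w G"
    and k: "int k \<noteq> d + e - fst w - snd w"
  shows "(\<Sum>i\<le>k. jacobian (hom_part w (d - int i) F) (hom_part w (e - int (k - i)) G)) = 0"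
proof (rule poly2_eqI)
  fix m
  let ?J = "\<lambda>i j. jacobian (hom_part w (d - int i) F) (hom_part w (e - int j) G)"
  have J: "coeff2 (?J i j) m = 0" if "mon_deg w m \<noteq> d + e - int (i + j) - fst w - snd w" for i j
  proof -
    have "euler w (?J i j) = of_int ((d - int i) + (e - int j) - fst w - snd w) * ?J i j"
      by (intro euler_jacobian euler_hom_part)
    then have "coeff2 (?J i j) m \<noteq> 0 \<Longrightarrow> mon_deg w m = (d - int i) + (e - int j) - fst w - snd w"
      unfolding euler_eq_iff by blast
    then show ?thesis
      using that by fastforce
  qed
  show "coeff2 (\<Sum>i\<le>k. ?J i (k - i)) m = coeff2 0 m"
  proof (cases "mon_deg w m = d + e - int k - fst w - snd w")
    case False
    then have "coeff2 (?J i (k - i)) m = 0" if "i \<le> k" for i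
      using that by (intro J) simp
    then show ?thesis
      by (simp add: coeff2_sum)
  next
    case True
    \<comment> \<open>\<open>N\<close> bounds the depth of both supports, which makes both
      decompositions finite, and \<open>N \<ge> k\<close> puts the whole diagonal
      \<open>i + j = k\<close> inside the square of indices.\<close>
    obtain N where N: "N \<ge> k" "\<forall>m\<in>supp F. d - mon_deg w m \<le> int N" "\<forall>m\<in>supp G. e - mon_deg w m \<le> int N"
    proof -
      let ?A = "insert k ((\<lambda>m. nat (d - mon_deg w m)) ` supp F \<union> (\<lambda>m. nat (e - mon_deg w m)) ` supp G)"
      have "x \<le> Max ?A" if "x \<in> ?A" for x
        using that finite_supp[of F] finite_supp[of G] by (intro Max_ge) auto
      then show ?thesis
        by (intro that[of "Max ?A"]) (auto simp flip: nat_le_iff)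
    qed
    have "F = (\<Sum>i\<le>N. hom_part w (d - int i) F)" "G = (\<Sum>j\<le>N. hom_part w (e - int j) G)"
      using N supp_mon_deg_le_wdeg[of _ F w] supp_mon_deg_le_wdeg[of _ G w] d e
      by (intro hom_part_sum[symmetric]; force)+
    then have "jacobian F G = (\<Sum>i\<le>N. \<Sum>j\<le>N. ?J i j)"
      by (metis jacobian_sum)
    then have "coeff2 (jacobian F G) m = (\<Sum>i\<le>N. \<Sum>j\<le>N. coeff2 (?J i j) m)"
      by (simp add: coeff2_sum)
    \<comment> \<open>Jacobians off the diagonal \<open>i + j = k\<close> have another degree than
      \<open>m\<close> and drop out.\<close>
    also have "\<dots> = (\<Sum>i\<le>N. \<Sum>j\<le>N. if i \<le> k \<and> j = k - i then coeff2 (?J i j) m else 0)"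
      using True by (intro sum.cong refl) (auto intro!: J)
    also have "\<dots> = (\<Sum>i\<le>N. if i \<le> k then coeff2 (?J i (k - i)) m else 0)"
      using N(1) by (intro sum.cong refl) auto
    also have "\<dots> = (\<Sum>i | i \<le> N \<and> i \<le> k. coeff2 (?J i (k - i)) m)"
      by (simp add: sum.inter_filter[symmetric])
    also have "{i. i \<le> N \<and> i \<le> k} = {..k}"
      using N(1) by auto
    finally have "coeff2 (\<Sum>i\<le>k. ?J i (k - i)) m = coeff2 (jacobian F G) m"
      by (simp add: coeff2_sum)
    moreover have "m \<noteq> (0, 0)"
      using True k by (auto simp: mon_deg_def)
    ultimately show ?thesis
      using const by (auto simp: coeff2_const2)
  qed
qed

section \<open>Vanishing Wronskians and constant rational functions\<close>

lemma coeff_mult_degree_le: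
  assumes "degree p \<le> a" "degree q \<le> b"
  shows "Polynomial.coeff (p * q) (a + b) = Polynomial.coeff p a * Polynomial.coeff q b"
proof -
  have "Polynomial.coeff p i * Polynomial.coeff q (a + b - i)
      = (if i = a then Polynomial.coeff p a * Polynomial.coeff q b else 0)" if "i \<le> a + b" for i
    using that assms by (cases i a rule: linorder_cases) (auto simp: coeff_eq_0)
  then show ?thesis
    by (simp add: coeff_mult)
qed

text \<open>Multiplication by the variable restores the degree lost by \<open>pderiv\<close>. The
  top coefficients then compare \<open>degree p\<close> with \<open>degree q\<close> up to a common
  nonzero factor, and characteristic 0 recovers the degrees.\<close>

lemma degree_eq_of_wronskian_eq_0:
  fixes p q :: "'a::{idom,ring_char_0} poly"
  assumes "pderiv p * q = p * pderiv q" "p \<noteq> 0" "q \<noteq> 0"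
  shows "degree p = degree q"
proof -
  have deg: "degree ([:0, 1:] * pderiv r) \<le> degree r"
    and coeff: "Polynomial.coeff ([:0, 1:] * pderiv r) (degree r) = of_nat (degree r) * lead_coeff r"
    for r :: "'a poly"
    by (auto simp: degree_pderiv coeff_pderiv coeff_pCons degree_pCons_le pderiv_eq_0_iff split: nat.splits)
  have "([:0, 1:] * pderiv p) * q = p * ([:0, 1:] * pderiv q)"
    using assms(1) by (metis mult.assoc mult.left_commute)
  then have "Polynomial.coeff (([:0, 1:] * pderiv p) * q) (degree p + degree q)
           = Polynomial.coeff (p * ([:0, 1:] * pderiv q)) (degree p + degree q)"
    by (rule arg_cong)
  then have "of_nat (degree p) * lead_coeff p * lead_coeff q = lead_coeff p * (of_nat (degree q) * lead_coeff q)"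
    by (simp only: coeff_mult_degree_le[OF deg order.refl] coeff_mult_degree_le[OF order.refl deg] coeff)
  then show ?thesis
    using assms by simp
qed

text \<open>The one-variable statement is applied twice: in \<open>y\<close> to the polynomials
  themselves, then in \<open>x\<close> to their leading coefficients, which inherit the relation as
  the top coefficient of the first hypothesis.\<close>

lemma degrees_eq_of_wronskians_eq_0:
  fixes P Q :: "'k::field_char_0 poly poly"
  assumes "deriv_x P * Q = P * deriv_x Q" "deriv_y P * Q = P * deriv_y Q" "P \<noteq> 0" "Q \<noteq> 0"
  shows "degree P = degree Q \<and> degree (lead_coeff P) = degree (lead_coeff Q)"
proof -
  have deg: "degree P = degree Q"
    using assms by (intro degree_eq_of_wronskian_eq_0) (simp_all add: deriv_y_def)
  have le: "degree (deriv_x R) \<le> degree R" for R :: "'k poly poly"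
    by (rule degree_le) (simp add: coeff_eq_0)
  have "Polynomial.coeff (deriv_x P * Q) (degree P + degree Q)
      = Polynomial.coeff (P * deriv_x Q) (degree P + degree Q)"
    using assms(1) by simp
  then have "pderiv (lead_coeff P) * lead_coeff Q = lead_coeff P * pderiv (lead_coeff Q)"
    by (simp only: coeff_mult_degree_le[OF le order.refl] coeff_mult_degree_le[OF order.refl le] coeff_deriv_x)
  moreover have "lead_coeff P \<noteq> 0" "lead_coeff Q \<noteq> 0"
    using assms by simp_all
  ultimately show ?thesis
    using deg degree_eq_of_wronskian_eq_0 by blast
qed

text \<open>Subtracting a constant multiple of \<open>Q\<close> cancels the lexicographically leading term.\<close>

lemma proportional_of_wronskians_eq_0:
  fixes P Q :: "'k::field_char_0 poly poly"
  assumes x: "deriv_x P * Q = P * deriv_x Q" and y: "deriv_y P * Q = P * deriv_y Q" and "Q \<noteq> 0"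
  obtains a where "P = const2 a * Q"
proof (cases "P = 0")
  case True
  then show ?thesis using that[of 0] by simp
next
  case False
  interpret X: derivation deriv_x by (rule derivation_deriv_x)
  interpret Y: derivation deriv_y by (rule derivation_deriv_y)
  have const: "deriv_x (const2 b) = 0" "deriv_y (const2 b) = 0" for b :: 'k
    by (rule poly_eqI; simp add: const2_def deriv_y_def coeff_pCons pderiv_pCons split: nat.splits)+
  define a where "a = lead_coeff (lead_coeff P) / lead_coeff (lead_coeff Q)"
  define R where "R = P - const2 a * Q"
  note degP = degrees_eq_of_wronskians_eq_0[OF x y False \<open>Q \<noteq> 0\<close>]
  have "R = 0"
  proof (rule ccontr)
    assume "R \<noteq> 0"
    have "deriv_x R * Q = R * deriv_x Q" "deriv_y R * Q = R * deriv_y Q"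
      using x y by (simp_all add: R_def X.diff Y.diff X.mult Y.mult const algebra_simps)
    note degR = degrees_eq_of_wronskians_eq_0[OF this \<open>R \<noteq> 0\<close> \<open>Q \<noteq> 0\<close>]
    \<comment> \<open>\<open>P\<close>, \<open>Q\<close> and \<open>R\<close> all have their
      lexicographically leading term at this monomial, so the choice of \<open>a\<close> makes the
      leading coefficient of \<open>R\<close> vanish.\<close>
    let ?m = "(degree (lead_coeff Q), degree Q)"
    have "lead_coeff (lead_coeff R) = coeff2 R ?m"
      using degR by (metis coeff2_def case_prod_conv)
    also have "\<dots> = coeff2 P ?m - a * lead_coeff (lead_coeff Q)"
      by (simp add: coeff2_def R_def const2_def)
    also have "coeff2 P ?m = lead_coeff (lead_coeff P)"
      using degP by (metis coeff2_def case_prod_conv)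
    also have "lead_coeff (lead_coeff P) - a * lead_coeff (lead_coeff Q) = 0"
      using \<open>Q \<noteq> 0\<close> by (simp add: a_def)
    finally show False
      using \<open>R \<noteq> 0\<close> by simp
  qed
  then show ?thesis
    using that[of a] by (simp add: R_def)
qed

text \<open>By the quotient rule, vanishing derivatives mean that numerator and denominator have
  zero Wronskians, hence are proportional over \<open>K\<close>.\<close>

lemma fract_deriv_eq_0_imp_const:
  fixes q :: "'k::field_char_0 poly poly fract"
  assumes "fract_deriv deriv_x q = 0" "fract_deriv deriv_y q = 0"
  obtains a where "q = to_fract (const2 a)"
proof -
  obtain A B where q: "q = Fraction_Field.Fract A B" "B \<noteq> 0" by (cases q)
  have "deriv_x A * B = A * deriv_x B" "deriv_y A * B = A * deriv_y B"
    using assms q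
    by (simp_all add: fract_deriv_Fract derivation_deriv_x derivation_deriv_y Zero_fract_def eq_fract)
  then obtain a where "A = const2 a * B"
    using q(2) by (rule proportional_of_wronskians_eq_0)
  then show ?thesis
    using that[of a] q by (simp add: Fract_conv_to_fract)
qed


section \<open>Coefficients of composed power series\<close>

text \<open>Expanding the power gives one product for each list of \<open>N\<close> exponents with
  sum \<open>n\<close>; lists containing 0 drop out because \<open>S\<close> has no constant
  term.\<close>

lemma fps_power_nth_lists:
  fixes S :: "'a::comm_ring_1 fps"
  assumes S0: "S $ 0 = 0"
  shows "(S ^ N) $ n = (\<Sum>l | l \<in> natpermute n N \<and> 0 \<notin> set l. \<Prod>k\<leftarrow>l. S $ k)"
proof (cases N)
  case 0
  then have "{l. l \<in> natpermute n N \<and> 0 \<notin> set l} = (if n = 0 then {[]} else {})"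
    by (auto simp: natpermute_def)
  then show ?thesis
    using 0 by simp
next
  case (Suc m)
  have "(S ^ N) $ n = (\<Sum>l\<in>natpermute n N. \<Prod>j=0..m. S $ (l ! j))"
    using fps_power_nth_Suc[of S m n] by (simp only: Suc Suc_eq_plus1)
  also have "\<dots> = (\<Sum>l\<in>natpermute n N. \<Prod>k\<leftarrow>l. S $ k)"
  proof (rule sum.cong[OF refl])
    fix l assume "l \<in> natpermute n N"
    then have "length l = Suc m"
      by (simp add: natpermute_def Suc)
    then show "(\<Prod>j=0..m. S $ (l ! j)) = (\<Prod>k\<leftarrow>l. S $ k)"
      by (simp add: prod.list_conv_set_nth atLeastLessThanSuc_atLeastAtMost)
  qed
  also have "\<dots> = (\<Sum>l | l \<in> natpermute n N \<and> 0 \<notin> set l. \<Prod>k\<leftarrow>l. S $ k)"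
  proof (intro sum.mono_neutral_right ballI)
    fix l assume "l \<in> natpermute n N - {l. l \<in> natpermute n N \<and> 0 \<notin> set l}"
    then have "0 \<in> set l" by simp
    then show "(\<Prod>k\<leftarrow>l. S $ k) = 0"
      using S0 by (induction l) auto
  qed (auto simp: natpermute_finite)
  finally show ?thesis .
qed

text \<open>The product along a list depends only on its multiset, so lists are grouped into fibres,
  each consisting of all orderings of one multiset.\<close>

lemma fps_power_nth_multisets:
  fixes S :: "'a::comm_ring_1 fps"
  assumes S0: "S $ 0 = 0"
  shows "(S ^ N) $ n = (\<Sum>M | 0 \<notin># M \<and> sum_mset M = n \<and> size M = N.
           of_nat (card (permutations_of_multiset M)) * (\<Prod>k\<in>#M. S $ k))"
proof -
  let ?L = "{l. l \<in> natpermute n N \<and> 0 \<notin> set l}"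
  have "(S ^ N) $ n = (\<Sum>l\<in>?L. \<Prod>k\<in>#mset l. S $ k)"
    by (simp add: fps_power_nth_lists[OF S0] prod_mset_prod_list flip: mset_map)
  also have "\<dots> = (\<Sum>M\<in>mset ` ?L. \<Sum>l | l \<in> ?L \<and> mset l = M. \<Prod>k\<in>#mset l. S $ k)"
    by (rule sum.image_gen) (simp add: natpermute_finite)
  also have "mset ` ?L = {M. 0 \<notin># M \<and> sum_mset M = n \<and> size M = N}"
  proof (intro equalityI subsetI)
    fix M assume M: "M \<in> {M. 0 \<notin># M \<and> sum_mset M = n \<and> size M = N}"
    obtain l where "mset l = M" using ex_mset by blast
    with M show "M \<in> mset ` ?L"
      by (intro image_eqI[of _ _ l]) (auto simp: natpermute_def sum_mset_sum_list)
  qed (auto simp: natpermute_def sum_mset_sum_list)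
  also have "(\<Sum>M\<in>\<dots>. \<Sum>l | l \<in> ?L \<and> mset l = M. \<Prod>k\<in>#mset l. S $ k)
      = (\<Sum>M\<in>\<dots>. of_nat (card (permutations_of_multiset M)) * (\<Prod>k\<in>#M. S $ k))"
  proof (rule sum.cong[OF refl])
    fix M assume M: "M \<in> {M. 0 \<notin># M \<and> sum_mset M = n \<and> size M = N}"
    have "{l. l \<in> ?L \<and> mset l = M} = permutations_of_multiset M"
      using M by (auto simp: natpermute_def permutations_of_multiset_def sum_mset_sum_list)
    then show "(\<Sum>l | l \<in> ?L \<and> mset l = M. \<Prod>k\<in>#mset l. S $ k)
        = of_nat (card (permutations_of_multiset M)) * (\<Prod>k\<in>#M. S $ k)"
      by (simp add: permutations_of_multiset_def)
  qed
  finally show ?thesis .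
qed

text \<open>
  A family \<open>\<nu>\<close> is encoded by the multiset of the weights \<open>d - \<alpha>\<close>, each with multiplicity \<open>\<nu>\<^sub>\<alpha>\<close>; the
  orderings of this multiset are the products contributing to a coefficient of a power of a series.
\<close>

definition family_of :: "int \<Rightarrow> nat multiset \<Rightarrow> int \<Rightarrow> nat" where
  "family_of d M = (\<lambda>\<alpha>. count M (nat (d - \<alpha>)))"

text \<open>\<open>nat\<close> sends every index \<alpha> \<ge> d to 0, so excluding the weight 0
  makes the family vanish there.\<close>

lemma family_of_support:
  assumes "0 \<notin># M"
  shows "{\<alpha>. family_of d M \<alpha> \<noteq> 0} = (\<lambda>k. d - int k) ` set_mset M"
proof (intro equalityI subsetI)
  fix \<alpha> assume "\<alpha> \<in> {\<alpha>. family_of d M \<alpha> \<noteq> 0}"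
  then have k: "nat (d - \<alpha>) \<in># M" by (simp add: family_of_def)
  with assms have "nat (d - \<alpha>) \<noteq> 0" by metis
  with k show "\<alpha> \<in> (\<lambda>k. d - int k) ` set_mset M"
    by (intro image_eqI[of _ _ "nat (d - \<alpha>)"]) auto
qed (auto simp: family_of_def)

lemma family_of_at [simp]: "family_of d M (d - int k) = count M k"
  by (simp add: family_of_def)

lemma
  assumes "0 \<notin># M"
  shows sum_family_of: "(\<Sum>\<alpha> | family_of d M \<alpha> \<noteq> 0. g \<alpha>) = (\<Sum>k\<in>set_mset M. g (d - int k))"
    and prod_family_of: "(\<Prod>\<alpha> | family_of d M \<alpha> \<noteq> 0. f \<alpha>) = (\<Prod>k\<in>set_mset M. f (d - int k))"
proof -
  have inj: "inj_on (\<lambda>k. d - int k) (set_mset M)"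
    by (auto simp: inj_on_def)
  show "(\<Sum>\<alpha> | family_of d M \<alpha> \<noteq> 0. g \<alpha>) = (\<Sum>k\<in>set_mset M. g (d - int k))"
    "(\<Prod>\<alpha> | family_of d M \<alpha> \<noteq> 0. f \<alpha>) = (\<Prod>k\<in>set_mset M. f (d - int k))"
    unfolding family_of_support[OF assms]
    by (simp_all add: sum.reindex[OF inj] prod.reindex[OF inj])
qed

lemma sum_mset_conv_sum_count: "sum_mset M = (\<Sum>k\<in>set_mset M. count M k * k)" for M :: "nat multiset"
proof -
  \<comment> \<open>Summing over a fixed finite superset keeps the index set unchanged when the
    induction adds an element.\<close>
  have "sum_mset M = (\<Sum>k\<in>A. count M k * k)" if "finite A" "set_mset M \<subseteq> A" for A
    using that(2)
  proof (induction M)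
    case (add x M)
    have "(\<Sum>k\<in>A. count (add_mset x M) k * k) = (\<Sum>k\<in>A. count M k * k + (if k = x then x else 0))"
      by (intro sum.cong) auto
    then show ?case
      using add \<open>finite A\<close> by (simp add: sum.distrib)
  qed simp
  then show ?thesis by simp
qed

text \<open>Multiplicities are recovered at the indices \<open>d - int k\<close>, which gives
  injectivity; reading a family at these indices gives the multiset for surjectivity.\<close>

lemma bij_betw_family_of:
  "bij_betw (family_of d) {M. 0 \<notin># M \<and> sum_mset M = n} (families d (int n))"
proof (rule bij_betwI')
  fix M M' assume M: "M \<in> {M. 0 \<notin># M \<and> sum_mset M = n}" "M' \<in> {M. 0 \<notin># M \<and> sum_mset M = n}"
  show "family_of d M = family_of d M' \<longleftrightarrow> M = M'"
    by (metis family_of_at multiset_eqI)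
next
  fix M assume M: "M \<in> {M. 0 \<notin># M \<and> sum_mset M = n}"
  then have M0: "0 \<notin># M" by simp
  have "(\<Sum>\<alpha> | family_of d M \<alpha> \<noteq> 0. (d - \<alpha>) * int (family_of d M \<alpha>)) = int (sum_mset M)"
    unfolding sum_family_of[OF M0] by (simp add: sum_mset_conv_sum_count mult.commute)
  moreover have "\<alpha> \<le> d - 1" if "family_of d M \<alpha> \<noteq> 0" for \<alpha>
    using that M by (cases "\<alpha> \<le> d - 1") (auto simp: family_of_def)
  moreover have "finite {\<alpha>. family_of d M \<alpha> \<noteq> 0}"
    unfolding family_of_support[OF M0] by simp
  ultimately show "family_of d M \<in> families d (int n)"
    using M by (auto simp: families_def)
next
  fix \<nu> assume \<nu>: "\<nu> \<in> families d (int n)"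
  define M where "M = Abs_multiset (\<lambda>k. \<nu> (d - int k))"
  \<comment> \<open>Finite support passes through the injection
    \<open>\<lambda>k. d - int k\<close>, so \<open>Abs_multiset\<close> really yields these
    multiplicities.\<close>
  have "finite ((\<lambda>k. d - int k) -` {\<alpha>. \<nu> \<alpha> \<noteq> 0})"
    using \<nu> by (intro finite_vimageI) (auto simp: families_def inj_on_def)
  then have count: "count M k = \<nu> (d - int k)" for k
    unfolding M_def by (subst count_Abs_multiset) (simp_all add: vimage_def)
  have le: "\<nu> \<alpha> = 0" if "\<alpha> > d - 1" for \<alpha>
    using \<nu> that by (force simp: families_def)
  have M: "0 \<notin># M"
    using le[of d] count[of 0] by (simp add: not_in_iff)
  have fam: "family_of d M = \<nu>"
  proof
    fix \<alpha> show "family_of d M \<alpha> = \<nu> \<alpha>"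
      using le by (cases "\<alpha> \<le> d") (simp_all add: family_of_def count)
  qed
  have "int n = (\<Sum>\<alpha> | family_of d M \<alpha> \<noteq> 0. (d - \<alpha>) * int (family_of d M \<alpha>))"
    using \<nu> by (simp add: families_def fam)
  also have "\<dots> = int (sum_mset M)"
    using M by (subst sum_family_of) (simp_all add: sum_mset_conv_sum_count mult.commute)
  finally have "n = sum_mset M"
    by (simp only: of_nat_eq_iff)
  then show "\<exists>M\<in>{M. 0 \<notin># M \<and> sum_mset M = n}. \<nu> = family_of d M"
    using M fam by auto
qed

text \<open>Multisets of size \<open>i\<close> describe coefficient \<open>n\<close> of
  \<open>S ^ i\<close>. Letting \<open>i\<close> run covers all multisets of total weight
  \<open>n\<close>, and the number of orderings is the multinomial coefficient.\<close>

lemma fps_compose_nth_families: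
  fixes R S :: "'a::field_char_0 fps"
  assumes S0: "S $ 0 = 0"
  shows "(R oo S) $ n = (\<Sum>\<nu>\<in>families d (int n). let N = (\<Sum>\<alpha> | \<nu> \<alpha> \<noteq> 0. \<nu> \<alpha>) in
    R $ N * (fact N / (\<Prod>\<alpha> | \<nu> \<alpha> \<noteq> 0. fact (\<nu> \<alpha>))) * (\<Prod>\<alpha> | \<nu> \<alpha> \<noteq> 0. (S $ nat (d - \<alpha>)) ^ \<nu> \<alpha>))"
proof -
  let ?M = "{M. 0 \<notin># M \<and> sum_mset M = n}"
  let ?t = "\<lambda>M. R $ size M * of_nat (card (permutations_of_multiset M)) * (\<Prod>k\<in>#M. S $ k)"
  have fin: "finite ?M"
    using bij_betw_finite[OF bij_betw_family_of[of 0 n]] finite_families by blast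
  \<comment> \<open>Weights are at least 1, so no multiset of total weight \<open>n\<close> has more
    than \<open>n\<close> elements and the range \<open>0..n\<close> misses none.\<close>
  have size_le: "size M \<le> sum_mset M" if "0 \<notin># M" for M :: "nat multiset"
    using that by (induction M) auto
  have "(R oo S) $ n = (\<Sum>i=0..n. \<Sum>M | M \<in> ?M \<and> size M = i. ?t M)"
    by (simp add: fps_compose_nth fps_power_nth_multisets[OF S0] sum_distrib_left mult.assoc conj_assoc)
  also have "\<dots> = (\<Sum>M\<in>?M. ?t M)"
    using fin size_le by (intro sum.group) auto
  also have "\<dots> = (\<Sum>M\<in>?M. let \<nu> = family_of d M; N = (\<Sum>\<alpha> | \<nu> \<alpha> \<noteq> 0. \<nu> \<alpha>) in
    R $ N * (fact N / (\<Prod>\<alpha> | \<nu> \<alpha> \<noteq> 0. fact (\<nu> \<alpha>))) * (\<Prod>\<alpha> | \<nu> \<alpha> \<noteq> 0. (S $ nat (d - \<alpha>)) ^ \<nu> \<alpha>))"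
  proof (rule sum.cong[OF refl])
    fix M assume "M \<in> ?M"
    then have M: "0 \<notin># M" by simp
    have "(\<Prod>k\<in>set_mset M. fact (count M k)) * card (permutations_of_multiset M) = fact (size M)"
      using card_permutations_of_multiset(1,2)[of M] by (simp add: dvd_div_eq_mult mult.commute)
    from arg_cong[OF this, of "of_nat :: nat \<Rightarrow> 'a"]
    have "(\<Prod>k\<in>set_mset M. fact (count M k)) * of_nat (card (permutations_of_multiset M)) = (fact (size M) :: 'a)"
      by simp
    moreover have "(\<Prod>k\<in>set_mset M. fact (count M k)) \<noteq> (0 :: 'a)"
      by simp
    ultimately have card: "of_nat (card (permutations_of_multiset M))
        = (fact (size M) / (\<Prod>k\<in>set_mset M. fact (count M k)) :: 'a)"
      by (simp add: eq_divide_eq mult.commute)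
    show "?t M = (let \<nu> = family_of d M; N = (\<Sum>\<alpha> | \<nu> \<alpha> \<noteq> 0. \<nu> \<alpha>) in
      R $ N * (fact N / (\<Prod>\<alpha> | \<nu> \<alpha> \<noteq> 0. fact (\<nu> \<alpha>))) * (\<Prod>\<alpha> | \<nu> \<alpha> \<noteq> 0. (S $ nat (d - \<alpha>)) ^ \<nu> \<alpha>))"
      unfolding Let_def sum_family_of[OF M] prod_family_of[OF M] card
      by (simp add: size_multiset_overloaded_eq image_prod_mset_multiplicity)
  qed
  also have "\<dots> = (\<Sum>\<nu>\<in>families d (int n). let N = (\<Sum>\<alpha> | \<nu> \<alpha> \<noteq> 0. \<nu> \<alpha>) in
    R $ N * (fact N / (\<Prod>\<alpha> | \<nu> \<alpha> \<noteq> 0. fact (\<nu> \<alpha>))) * (\<Prod>\<alpha> | \<nu> \<alpha> \<noteq> 0. (S $ nat (d - \<alpha>)) ^ \<nu> \<alpha>))"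
    unfolding Let_def by (rule sum.reindex_bij_betw[OF bij_betw_family_of])
  finally show ?thesis .
qed


section \<open>Rational powers of a graded power series\<close>

text \<open>A derivation vanishes on rational numbers; the chain rule asks for exactly this of the
  coefficients of the binomial series.\<close>

lemma derivation_gbinomial_rat:
  fixes D :: "'a::field_char_0 \<Rightarrow> 'a"
  assumes D: "derivation D"
  shows "D ((of_int n / of_int d) gchoose k) = 0"
proof -
  interpret derivation D by fact
  let ?c = "of_int n / of_int d :: 'a"
  have c: "D ?c = 0"
    using D by (rule derivation_of_rat_quotient)
  have "D (\<Prod>i = 0..<m. ?c - of_nat i) = 0" for m
    by (induction m) (simp_all add: mult diff c)
  moreover have "D (fact k) = 0"
    by (metis of_nat of_nat_fact)
  ultimately have "D ((\<Prod>i = 0..<k. ?c - of_nat i) / fact k) = 0"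
    by (subst derivation_divide[OF D]) simp_all
  then show ?thesis
    by (simp add: gbinomial_prod_rev)
qed

text \<open>\<open>U\<close> plays the role of \<Phi> to the power \<open>n / d\<close>. Of
  \<open>h\<close>, only the differential equation of \<open>f\<close> to the power
  \<open>n / d\<close> is asked, so no root of \<open>f\<close> has to lie in the field.\<close>

lemma fps_binomial_compose_log_deriv:
  fixes D :: "'a::field_char_0 \<Rightarrow> 'a" and n d :: int
  assumes D: "derivation D" and S0: "S $ 0 = 0" and d: "d \<noteq> 0"
    and h: "of_int d * f * D h = of_int n * h * D f"
  defines "U \<equiv> fps_const h * (fps_binomial (of_int n / of_int d) oo S)"
    and "\<Phi> \<equiv> fps_const f * (1 + S)"
  shows "of_int d * \<Phi> * fps_coeffwise D U = of_int n * U * fps_coeffwise D \<Phi>"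
proof -
  interpret C: derivation "fps_coeffwise D" by (rule derivation_fps_coeffwise) fact
  define c where "c = (of_int n / of_int d :: 'a)"
  define R where "R = fps_binomial c oo S"
  define T where "T = fps_deriv (fps_binomial c) oo S"
  have const: "D (fps_binomial c $ k) = 0" for k
    using derivation_gbinomial_rat[OF D] by (simp add: c_def)
  \<comment> \<open>The differential equation of the binomial series, into which \<open>S\<close> is
    substituted next.\<close>
  have "(1 + fps_X) * fps_deriv (fps_binomial c) = fps_const c * fps_binomial c"
    using inverse_mult_eq_1'[of "1 + fps_X :: 'a fps"] by (simp add: fps_binomial_deriv fps_divide_unit)
  then have "((1 + fps_X) * fps_deriv (fps_binomial c)) oo S = (fps_const c * fps_binomial c) oo S"
    by simp
  then have T: "(1 + S) * T = fps_const c * R"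
    using S0 by (simp add: T_def R_def fps_compose_mult_distrib fps_compose_add_distrib)
  have dc: "of_int d * fps_const c = (of_int n :: 'a fps)"
    using d by (simp add: c_def flip: fps_of_int)
  have DR: "fps_coeffwise D R = T * fps_coeffwise D S"
    unfolding R_def T_def by (rule fps_coeffwise_compose[OF D S0 const])
  have "of_int d * fps_const f * fps_const (D h) = of_int n * fps_const h * fps_const (D f)"
    using arg_cong[OF h, of fps_const] by (simp add: fps_of_int flip: fps_const_mult)
  then have h': "of_int d * (fps_const f * fps_const (D h)) = of_int n * (fps_const h * fps_const (D f))"
    by (simp add: mult.assoc)
  have U: "U = fps_const h * R"
    by (simp add: U_def R_def c_def)
  have "of_int d * \<Phi> * fps_coeffwise D U
      = (of_int d * (fps_const f * fps_const (D h))) * (R * (1 + S))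
        + of_int d * fps_const f * fps_const h * ((1 + S) * T) * fps_coeffwise D S"
    unfolding U \<Phi>_def C.mult fps_coeffwise_const[OF D] DR by (simp add: algebra_simps del: fps_const_mult)
  also have "\<dots> = of_int n * U * (fps_const (D f) * (1 + S))
        + (of_int d * fps_const c) * fps_const f * U * fps_coeffwise D S"
    unfolding h' T U by (simp add: algebra_simps del: fps_const_mult)
  also have "\<dots> = of_int n * U * fps_coeffwise D \<Phi>"
    unfolding dc \<Phi>_def C.mult C.add C.one fps_coeffwise_const[OF D] by (simp add: algebra_simps del: fps_const_mult)
  finally show ?thesis .
qed

text \<open>On \<open>S\<close> the coefficientwise action of \<open>E\<close> is
  \<open>- X d/dX\<close>; both operators obey the chain rule, so they agree on
  \<open>R oo S\<close> too.\<close>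

lemma fps_coeffwise_compose_graded:
  fixes E :: "'a::field \<Rightarrow> 'a"
  assumes E: "derivation E" and S0: "S $ 0 = 0" and R: "\<And>n. E (R $ n) = 0"
    and S: "\<And>n. E (S $ n) = - of_nat n * S $ n"
  shows "E ((R oo S) $ n) = - of_nat n * (R oo S) $ n"
proof -
  have "fps_coeffwise E S = - (fps_X * fps_deriv S)"
    by (rule fps_ext) (simp add: S fps_mult_fps_X_deriv_shift)
  then have "fps_coeffwise E (R oo S) = - (fps_X * fps_deriv (R oo S))"
    using fps_coeffwise_compose[OF E S0 R] fps_compose_deriv[OF S0, of R] by (simp add: mult_ac)
  then have "fps_coeffwise E (R oo S) $ n = - (fps_X * fps_deriv (R oo S)) $ n"
    by simp
  then show ?thesis
    by (cases n) (simp_all add: algebra_simps)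
qed

lemma fps_mult_nth_leading:
  fixes A B :: "'a::comm_ring_1 fps"
  assumes "\<And>k. k < n \<Longrightarrow> B $ k = 0"
  shows "(A * B) $ n = A $ 0 * B $ n"
proof -
  have "(A * B) $ n = (\<Sum>i=0..n. if i = 0 then A $ 0 * B $ n else 0)"
    unfolding fps_mult_nth using assms by (intro sum.cong) auto
  then show ?thesis
    by simp
qed

text \<open>The vanishing Jacobian makes the gradients of \<open>f\<close> and \<open>h\<close>
  proportional, and the two Euler relations determine the factor as
  \<open>n h / (d f)\<close>.\<close>

lemma
  fixes Dx Dy :: "'q::field \<Rightarrow> 'q"
  assumes f: "a * Dx f + b * Dy f = of_int d * f"
    and h: "a * Dx h + b * Dy h = of_int n * h"
    and jac: "Dx f * Dy h = Dx h * Dy f"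
  shows log_deriv_x: "of_int d * f * Dx h = of_int n * h * Dx f"
    and log_deriv_y: "of_int d * f * Dy h = of_int n * h * Dy f"
proof -
  have "of_int d * f * Dx h = a * Dx f * Dx h + b * (Dx h * Dy f)"
    unfolding f[symmetric] by (simp add: algebra_simps)
  also have "\<dots> = (a * Dx h + b * Dy h) * Dx f"
    unfolding jac[symmetric] by (simp add: algebra_simps)
  finally show "of_int d * f * Dx h = of_int n * h * Dx f"
    unfolding h .
  have "of_int d * f * Dy h = a * (Dx f * Dy h) + b * Dy f * Dy h"
    unfolding f[symmetric] by (simp add: algebra_simps)
  also have "\<dots> = (a * Dx h + b * Dy h) * Dy f"
    unfolding jac by (simp add: algebra_simps)
  finally show "of_int d * f * Dy h = of_int n * h * Dy f"
    unfolding h .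
qed

text \<open>\<open>h \<mu>\<close> is what remains of coefficient \<mu> of \<Gamma> after the
  contributions of smaller indices. It absorbs both the unknown constant and the fractional power of
  \<open>\<Phi> $ 0\<close>, so the recursion stays inside the base field; the conclusion records
  the equations that identify it later.\<close>

lemma magnus_coefficients:
  fixes Dx Dy E :: "'q::field_char_0 \<Rightarrow> 'q" and \<Phi> \<Gamma> :: "'q fps" and h :: "nat \<Rightarrow> 'q"
    and d e :: int
  defines "S \<equiv> fps_const (inverse (\<Phi> $ 0)) * \<Phi> - 1"
  assumes Dx: "derivation Dx" and Dy: "derivation Dy"
    and E: "\<And>z. E z = a * Dx z + b * Dy z"
    and d: "d \<noteq> 0" and \<Phi>0: "\<Phi> $ 0 \<noteq> 0"
    and E\<Phi>: "\<And>k. E (\<Phi> $ k) = of_int (d - int k) * \<Phi> $ k"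
    and E\<Gamma>: "\<And>k. E (\<Gamma> $ k) = of_int (e - int k) * \<Gamma> $ k"
    and jac: "\<And>k. k \<le> M \<Longrightarrow> (fps_coeffwise Dx \<Phi> * fps_coeffwise Dy \<Gamma>) $ k
                               = (fps_coeffwise Dx \<Gamma> * fps_coeffwise Dy \<Phi>) $ k"
    and h: "\<And>n. h n = \<Gamma> $ n
       - (\<Sum>\<gamma><n. h \<gamma> * (fps_binomial (of_int (e - int \<gamma>) / of_int d) oo S) $ (n - \<gamma>))"
  shows "\<mu> \<le> M \<Longrightarrow> E (h \<mu>) = of_int (e - int \<mu>) * h \<mu>
      \<and> of_int d * \<Phi> $ 0 * Dx (h \<mu>) = of_int (e - int \<mu>) * h \<mu> * Dx (\<Phi> $ 0)
      \<and> of_int d * \<Phi> $ 0 * Dy (h \<mu>) = of_int (e - int \<mu>) * h \<mu> * Dy (\<Phi> $ 0)"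
proof (induction \<mu> rule: less_induct)
  case (less \<mu>)
  define R where "R = (\<lambda>\<gamma>. fps_binomial (of_int (e - int \<gamma>) / of_int d :: 'q) oo S)"
  define U where "U = (\<lambda>\<gamma>. fps_const (h \<gamma>) * R \<gamma>)"
  \<comment> \<open>\<Gamma> with all terms of index below \<mu> removed; its coefficients below
    \<mu> will vanish and the one at \<mu> is \<open>h \<mu>\<close>.\<close>
  define H where "H = \<Gamma> - (\<Sum>\<gamma><\<mu>. fps_X ^ \<gamma> * U \<gamma>)"
  let ?X = "fps_coeffwise Dx" and ?Y = "fps_coeffwise Dy"
  interpret X: derivation ?X by (rule derivation_fps_coeffwise) fact
  interpret Y: derivation ?Y by (rule derivation_fps_coeffwise) fact
  have "derivation (\<lambda>z. a * Dx z + b * Dy z)"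
    using Dx Dy by (rule derivation.linear_combination)
  moreover have "E = (\<lambda>z. a * Dx z + b * Dy z)"
    using E by blast
  ultimately have dE: "derivation E"
    by simp
  interpret E: derivation E by (rule dE)
  have S0: "S $ 0 = 0"
    using \<Phi>0 by (simp add: S_def)
  have ES: "E (S $ n) = - of_nat n * S $ n" for n
  proof (cases "n = 0")
    case False
    then have Sn: "S $ n = \<Phi> $ n / \<Phi> $ 0"
      by (simp add: S_def field_simps)
    have "E (S $ n) = (of_int (d - int n) * \<Phi> $ n * \<Phi> $ 0 - \<Phi> $ n * (of_int d * \<Phi> $ 0)) / (\<Phi> $ 0)\<^sup>2"
      using E\<Phi>[of 0] \<Phi>0 unfolding Sn by (subst derivation_divide[OF dE]) (simp_all add: E\<Phi>)
    also have "\<dots> = - of_nat n * (\<Phi> $ n / \<Phi> $ 0)"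
      using \<Phi>0 by (simp add: power2_eq_square field_simps)
    finally show ?thesis
      by (simp add: Sn)
  qed (simp add: S0)
  have ER: "E (R \<gamma> $ n) = - of_nat n * R \<gamma> $ n" for \<gamma> n
    unfolding R_def
    by (rule fps_coeffwise_compose_graded[OF dE S0 _ ES]) (simp add: derivation_gbinomial_rat[OF dE] del: of_int_diff)
  have R0: "R \<gamma> $ 0 = 1" for \<gamma>
    by (simp add: R_def)
  have h_R: "h n = \<Gamma> $ n - (\<Sum>\<gamma><n. h \<gamma> * R \<gamma> $ (n - \<gamma>))" for n
    unfolding R_def by (rule h)
  have H: "H $ k = \<Gamma> $ k - (\<Sum>\<gamma><\<mu>. if k < \<gamma> then 0 else h \<gamma> * R \<gamma> $ (k - \<gamma>))" for k
    by (simp add: H_def U_def fps_sum_nth fps_X_power_mult_nth cong: if_cong)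
  have H_less: "H $ k = 0" if "k < \<mu>" for k
  proof -
    \<comment> \<open>The term \<gamma> = k contributes \<open>h k\<close>, as
      \<open>R k $ 0 = 1\<close>; the recursion for \<open>h k\<close> then gives full
      cancellation.\<close>
    have "(\<Sum>\<gamma><\<mu>. if k < \<gamma> then 0 else h \<gamma> * R \<gamma> $ (k - \<gamma>)) = (\<Sum>\<gamma><Suc k. h \<gamma> * R \<gamma> $ (k - \<gamma>))"
      using that by (intro sum.mono_neutral_cong_right) auto
    also have "\<dots> = \<Gamma> $ k"
      using h_R[of k] by (simp add: R0)
    finally show ?thesis
      by (simp add: H)
  qed
  have H_\<mu>: "H $ \<mu> = h \<mu>"
    unfolding H h_R[of \<mu>] by (intro arg_cong2[of _ _ _ _ "(-)"] sum.cong) auto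
  have \<Phi>: "\<Phi> = fps_const (\<Phi> $ 0) * (1 + S)"
    using \<Phi>0 by (simp add: S_def mult.assoc[symmetric])
  have jac_U: "?X \<Phi> * ?Y (U \<gamma>) = ?X (U \<gamma>) * ?Y \<Phi>" if "\<gamma> < \<mu>" for \<gamma>
  proof -
    let ?n = "e - int \<gamma>"
    have *: "of_int d * \<Phi> * ?X (U \<gamma>) = of_int ?n * U \<gamma> * ?X \<Phi>"
      "of_int d * \<Phi> * ?Y (U \<gamma>) = of_int ?n * U \<gamma> * ?Y \<Phi>"
      unfolding U_def R_def
      using less.IH[OF that] less.prems that \<Phi>
        fps_binomial_compose_log_deriv[OF Dx S0 d, of "\<Phi> $ 0" "h \<gamma>" ?n]
        fps_binomial_compose_log_deriv[OF Dy S0 d, of "\<Phi> $ 0" "h \<gamma>" ?n]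
      by simp_all
    \<comment> \<open>After multiplication by \<open>of_int d * \<Phi>\<close>, both derivatives of
      \<open>U \<gamma>\<close> are the same multiple of those of \<Phi>; this nonzero factor is
      cancelled at the end.\<close>
    have "of_int d * \<Phi> * (?X \<Phi> * ?Y (U \<gamma>)) = ?X \<Phi> * (of_int d * \<Phi> * ?Y (U \<gamma>))"
      by (simp only: mult_ac)
    also have "\<dots> = (of_int ?n * U \<gamma> * ?X \<Phi>) * ?Y \<Phi>"
      unfolding * by (simp only: mult_ac)
    also have "\<dots> = of_int d * \<Phi> * (?X (U \<gamma>) * ?Y \<Phi>)"
      unfolding *[symmetric] by (simp only: mult_ac)
    finally show ?thesis
      using d \<Phi>0 by (auto simp: fps_of_int[symmetric])
  qed
  have "?X \<Phi> * ?Y (fps_X ^ \<gamma> * U \<gamma>) = ?X (fps_X ^ \<gamma> * U \<gamma>) * ?Y \<Phi>" if "\<gamma> < \<mu>" for \<gamma>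
    using jac_U[OF that] by (simp add: X.mult Y.mult Dx Dy mult_ac)
  then have "?X \<Phi> * ?Y (\<Sum>\<gamma><\<mu>. fps_X ^ \<gamma> * U \<gamma>) = ?X (\<Sum>\<gamma><\<mu>. fps_X ^ \<gamma> * U \<gamma>) * ?Y \<Phi>"
    unfolding X.sum Y.sum sum_distrib_left sum_distrib_right by (intro sum.cong) auto
  \<comment> \<open>Removing terms with zero Jacobian keeps the relation at order \<mu>. Because
    \<open>H\<close> starts at order \<mu>, only the product of lowest coefficients survives
    there.\<close>
  then have "(?X \<Phi> * ?Y H) $ \<mu> = (?X H * ?Y \<Phi>) $ \<mu>"
    using jac[OF less.prems] by (simp add: H_def X.diff Y.diff algebra_simps)
  moreover have "(?X \<Phi> * ?Y H) $ \<mu> = ?X \<Phi> $ 0 * ?Y H $ \<mu>"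
    by (rule fps_mult_nth_leading) (simp add: H_less derivation.zero[OF Dy])
  moreover have "(?Y \<Phi> * ?X H) $ \<mu> = ?Y \<Phi> $ 0 * ?X H $ \<mu>"
    by (rule fps_mult_nth_leading) (simp add: H_less derivation.zero[OF Dx])
  ultimately have jac_h: "Dx (\<Phi> $ 0) * Dy (h \<mu>) = Dx (h \<mu>) * Dy (\<Phi> $ 0)"
    by (simp add: H_\<mu> mult.commute)
  have "E (h \<gamma> * R \<gamma> $ (\<mu> - \<gamma>)) = of_int (e - int \<mu>) * (h \<gamma> * R \<gamma> $ (\<mu> - \<gamma>))" if "\<gamma> < \<mu>" for \<gamma>
  proof -
    have "E (h \<gamma>) = of_int (e - int \<gamma>) * h \<gamma>"
      using less.IH[OF that] less.prems that by simp
    then show ?thesis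
      using that by (simp only: E.mult ER) (simp add: of_nat_diff algebra_simps)
  qed
  then have Eh: "E (h \<mu>) = of_int (e - int \<mu>) * h \<mu>"
    unfolding h_R[of \<mu>] E.diff E.sum E\<Gamma> right_diff_distrib sum_distrib_left
    by (intro arg_cong2[of _ _ _ _ "(-)"] sum.cong) auto
  have "E (\<Phi> $ 0) = of_int d * \<Phi> $ 0"
    using E\<Phi>[of 0] by simp
  then show ?case
    using Eh log_deriv_x[OF _ _ jac_h] log_deriv_y[OF _ _ jac_h] E by metis
qed


section \<open>Roots of rational functions\<close>

text \<open>Prime factors of \<open>b\<close> are removed one at a time: a prime \<open>p\<close>
  with \<open>p ^ m dvd a ^ m\<close> divides \<open>a\<close>, and cancelling \<open>p ^ m\<close>
  leaves the same problem for the cofactors.\<close>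

lemma power_dvd_power_imp_dvd:
  fixes a b :: "'a::ufd"
  assumes "b ^ m dvd a ^ m" "m > 0"
  shows "b dvd a"
proof (cases "b = 0 \<or> b dvd 1")
  case True
  then show ?thesis
  proof
    assume "b = 0"
    then show ?thesis
      using assms by (simp add: power_0_left)
  next
    assume "b dvd 1"
    then show ?thesis
      by (rule dvd_trans) simp
  qed
next
  case False
  then obtain M where M: "mset_factors M b"
    using mset_factors_exist by blast
  have "\<forall>p\<in>#M. irreducible p \<Longrightarrow> prod_mset M ^ m dvd a ^ m \<Longrightarrow> prod_mset M dvd a"
  proof (induction M arbitrary: a)
    case (add p M)
    then have p: "prime_elem p" by simp
    have "p ^ m dvd a ^ m"
      using add.prems(2) by (auto simp: power_mult_distrib intro: dvd_mult_left)
    then have "p dvd a"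
      using p \<open>m > 0\<close> by (metis dvd_power dvd_trans prime_elem_dvd_power)
    then obtain c where c: "a = p * c" ..
    have "prod_mset M ^ m dvd c ^ m"
      using add.prems(2) p by (auto simp: c power_mult_distrib)
    then show ?case
      using add by (simp add: c mult_dvd_mono)
  qed simp
  then show ?thesis
    using M assms(1) by (auto simp: mset_factors_def)
qed

lemma to_fract_power: "to_fract (a ^ n) = to_fract a ^ n"
  by (induction n) simp_all

text \<open>Clearing denominators gives \<open>b ^ m dvd a ^ m\<close>, so the denominator
  \<open>b\<close> divides the numerator \<open>a\<close>.\<close>

lemma root_of_to_fract:
  fixes z :: "'a::ufd fract"
  assumes "z ^ m = to_fract p" "m > 0"
  obtains q where "z = to_fract q"
proof -
  obtain a b where z: "z = to_fract a / to_fract b" "b \<noteq> 0"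
    by (cases z) (auto simp: Fract_conv_to_fract)
  then have "to_fract a = to_fract b * z" by simp
  then have "to_fract (a ^ m) = to_fract (b ^ m * p)"
    by (simp add: to_fract_power power_mult_distrib assms(1))
  then have "b ^ m dvd a ^ m"
    by (simp only: to_fract_eq_iff dvd_triv_left)
  then obtain c where "a = b * c"
    using power_dvd_power_imp_dvd \<open>m > 0\<close> by blast
  then show ?thesis
    using that[of c] z by simp
qed

text \<open>The polynomial \<open>X ^ n - a\<close> already splits over the algebraically closed
  field, so its image acquires no new roots in the larger field. This is how elements are recognized
  as constants from \<open>K\<close>.\<close>

lemma alg_closed_root_in_range:
  fixes \<phi> :: "'a::alg_closed_field \<Rightarrow> 'b::field"
  assumes "field_hom \<phi>" and "t ^ n = \<phi> a" and "n > 0"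
  shows "t \<in> range \<phi>"
proof -
  interpret field_hom \<phi> by fact
  interpret P: map_poly_idom_hom \<phi> ..
  define p where "p = Polynomial.monom 1 n - [:a:]"
  have "Polynomial.coeff p n = 1"
    using \<open>n > 0\<close> by (simp add: p_def coeff_pCons split: nat.splits)
  then have "p \<noteq> 0" by auto
  then obtain A where A: "p = Polynomial.smult (Polynomial.lead_coeff p) (\<Prod>x\<in>#A. [:- x, 1:])"
    using alg_closed_imp_factorization by blast
  have "poly (map_poly \<phi> p) t = 0"
    using assms(2) by (simp add: p_def hom_distribs poly_monom map_poly_monom)
  moreover have "poly (map_poly \<phi> (\<Prod>x\<in>#B. [:- x, 1:])) t = (\<Prod>x\<in>#B. t - \<phi> x)" for B
    by (induction B) (simp_all add: hom_distribs algebra_simps)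
  ultimately have "\<phi> (Polynomial.lead_coeff p) * (\<Prod>x\<in>#A. t - \<phi> x) = 0"
    by (subst (asm) A) (simp add: hom_distribs)
  then show ?thesis
    using \<open>p \<noteq> 0\<close> by auto
qed

definition frac_const :: "'k::field \<Rightarrow> 'k poly poly fract" where
  "frac_const a = to_fract (const2 a)"

lemma field_hom_frac_const: "field_hom frac_const"
  by unfold_locales (simp_all add: frac_const_def const2_add const2_mult)

text \<open>With \<open>g = gcd(a, b)\<close>, the quotient \<open>s\<close> of \<open>h\<close> to
  the power \<open>a / g\<close> by \<open>p\<close> to the power \<open>b / g\<close> is a root of
  unity, hence a constant. Moving a root of \<open>s\<close> into \<open>h\<close> makes
  \<open>p\<close> to the power \<open>b / g\<close> an \<open>a / g\<close>-th power, and Bezout's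
  identity carries this over to \<open>p\<close>.\<close>

lemma power_int_eq_imp_power:
  fixes p h :: "'k::alg_closed_field poly poly fract"
  assumes eq: "h ^ a = p powi b" and "a > 0" "p \<noteq> 0"
  obtains z where "p = z ^ nat (int a div gcd (int a) b)"
proof -
  interpret c: field_hom "frac_const :: 'k \<Rightarrow> _" by (rule field_hom_frac_const)
  define g where "g = gcd (int a) b"
  define a' b' where "a' = int a div g" and "b' = b div g"
  have g: "g > 0" using \<open>a > 0\<close> by (simp add: g_def)
  have ab: "int a = a' * g" "b = b' * g"
    by (simp_all add: a'_def b'_def g_def)
  have a': "a' > 0"
    using ab(1) g \<open>a > 0\<close> by (metis of_nat_0_less_iff zero_less_mult_pos2)
  have h: "h \<noteq> 0"
    using assms by (auto simp: power_0_left)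
  have "gcd a' b' = 1"
    unfolding a'_def b'_def g_def using \<open>a > 0\<close> by (intro div_gcd_coprime[THEN coprime_imp_gcd_eq_1]) simp
  then obtain i j where ij: "i * a' + j * b' = 1"
    using bezout_int[of a' b'] by auto
  define s where "s = h powi a' / p powi b'"
  have "s powi g = h powi (a' * g) / p powi (b' * g)"
    by (simp add: s_def power_int_divide_distrib power_int_mult)
  also have "\<dots> = 1"
    using eq \<open>p \<noteq> 0\<close> unfolding ab[symmetric] by simp
  finally have "s ^ nat g = frac_const 1"
    using g by (simp add: power_int_def)
  then obtain t where t: "s = frac_const t"
    using alg_closed_root_in_range[OF field_hom_frac_const] g by (metis imageE zero_less_nat_eq)
  have "s \<noteq> 0"
    using h \<open>p \<noteq> 0\<close> by (simp add: s_def)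
  obtain r where r: "r ^ nat a' = t"
    using nth_root_exists[of "nat a'" t] a' by auto
  define y where "y = frac_const r"
  have y: "y powi a' = s"
    using a' by (simp add: y_def power_int_def t flip: r c.hom_power)
  then have "y \<noteq> 0"
    using \<open>s \<noteq> 0\<close> a' by (auto simp: power_int_0_left_if)
  have pb: "p powi b' = h powi a' / y powi a'"
    using h \<open>p \<noteq> 0\<close> \<open>s \<noteq> 0\<close> by (simp add: y s_def)
  have "p = p powi (i * a' + j * b')"
    by (simp add: ij)
  also have "\<dots> = (p powi i) powi a' * (p powi b') powi j"
    using \<open>p \<noteq> 0\<close> by (simp add: power_int_add mult.commute[of j] power_int_mult)
  also have "\<dots> = (p powi i * (h / y) powi j) powi a'"
    unfolding pb power_int_divide_distrib[symmetric] power_int_mult_distrib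
    by (simp add: mult.commute flip: power_int_mult)
  finally show ?thesis
    using a' that[of "p powi i * (h / y) powi j"] by (simp add: power_int_def a'_def g_def)
qed

text \<open>\<open>GREATEST\<close> needs a bound. The degree in \<open>y\<close> serves if it is
  positive; otherwise \<open>P\<close> is a nonconstant polynomial in \<open>x\<close> alone and the
  second summand bounds \<open>r\<close>.\<close>

lemma nth_power_exponent_le:
  fixes P :: "'k::field poly poly"
  assumes "P \<notin> range const2" "is_nth_power r P"
  shows "r \<le> Polynomial.degree P + Polynomial.degree (Polynomial.coeff P 0)"
proof -
  obtain q where q: "P = q ^ r"
    using assms(2) by (rule is_nth_powerE)
  have "P \<noteq> 0" using assms(1) by (metis const2_0 rangeI)
  show ?thesis
  proof (cases "Polynomial.degree P = 0")
    case False
    have "q \<noteq> 0 \<or> r = 0"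
      using \<open>P \<noteq> 0\<close> by (auto simp: q power_0_left)
    then have "Polynomial.degree P = r * Polynomial.degree q"
      by (auto simp: q degree_power_eq)
    then show ?thesis
      using False by (cases "Polynomial.degree q") auto
  next
    case True
    have "r = 0 \<or> Polynomial.degree q = 0"
      using True \<open>P \<noteq> 0\<close> by (cases "r = 0") (auto simp: q degree_power_eq)
    then show ?thesis
    proof
      assume "Polynomial.degree q = 0"
      then obtain c where c: "q = [:c:]" by (metis degree_eq_zeroE)
      have P: "P = [:c ^ r:]"
        by (simp add: q c poly_const_pow)
      have "c ^ r \<noteq> 0"
        using \<open>P \<noteq> 0\<close> P by auto
      moreover have "Polynomial.degree (c ^ r) \<noteq> 0"
      proof
        assume "Polynomial.degree (c ^ r) = 0"
        then obtain a where "c ^ r = [:a:]" by (rule degree_eq_zeroE)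
        then have "P = const2 a" by (simp add: P const2_def)
        then show False using assms(1) by blast
      qed
      ultimately have "Polynomial.degree (c ^ r) = r * Polynomial.degree c" "Polynomial.degree c \<noteq> 0"
        by (cases "c = 0"; simp add: degree_power_eq power_0_left split: if_splits)+
      then show ?thesis
        using P by (cases "Polynomial.degree c") auto
    qed simp
  qed
qed

text \<open>Write \<open>P = p ^ r\<close> with \<open>r\<close> maximal. The relation makes
  \<open>p\<close> an \<open>m\<close>-th power for \<open>m = a / gcd(a, r b)\<close>, first in
  \<open>K(x,y)\<close> and then in \<open>K[x,y]\<close>; maximality forces
  \<open>m = 1\<close>.\<close>

lemma max_power_exponent_dvd:
  fixes P :: "'k::alg_closed_field poly poly"
  assumes P: "P \<notin> range const2" and "a > 0" and h: "h ^ a = to_fract P powi b"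
  shows "int a dvd int (max_power_exponent P) * b"
proof -
  define r where "r = max_power_exponent P"
  let ?Q = "\<lambda>r. r > 0 \<and> is_nth_power r P"
  have bound: "\<forall>n. ?Q n \<longrightarrow> n \<le> Polynomial.degree P + Polynomial.degree (Polynomial.coeff P 0)"
    using nth_power_exponent_le[OF P] by blast
  have "?Q 1"
    by (auto simp: is_nth_power_def intro: exI[of _ P])
  then have r: "r > 0" "is_nth_power r P"
    using GreatestI_nat[of ?Q, OF \<open>?Q 1\<close>] bound unfolding r_def max_power_exponent_def by blast+
  have max: "n \<le> r" if "n > 0" "is_nth_power n P" for n
    unfolding r_def max_power_exponent_def using that bound by (intro Greatest_le_nat) auto
  obtain p where p: "P = p ^ r"
    using r(2) by (rule is_nth_powerE)
  have "P \<noteq> 0" using P by (metis const2_0 rangeI)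
  then have "p \<noteq> 0" using r(1) by (auto simp: p)
  have "h ^ a = to_fract p powi (int r * b)"
    by (simp add: h p to_fract_power power_int_mult)
  then obtain z where z: "to_fract p = z ^ nat (int a div gcd (int a) (int r * b))"
    using power_int_eq_imp_power \<open>a > 0\<close> \<open>p \<noteq> 0\<close> by (metis to_fract_eq_0_iff)
  define m where "m = nat (int a div gcd (int a) (int r * b))"
  have "int a div gcd (int a) (int r * b) > 0"
    using \<open>a > 0\<close> by (simp add: pos_imp_zdiv_pos_iff zdvd_imp_le)
  then have m: "m > 0" "int m = int a div gcd (int a) (int r * b)"
    by (simp_all add: m_def)
  obtain q where "z = to_fract q"
    using root_of_to_fract[of z m p] z m(1) unfolding m_def by metis
  then have "p = q ^ m"
    using z by (simp add: m_def flip: to_fract_power)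
  then have "P = q ^ (m * r)"
    by (simp add: p power_mult)
  then have "m * r \<le> r"
    using max m(1) r(1) by (simp add: is_nth_powerI)
  then have "m = 1"
    using m(1) r(1) by (metis le_antisym less_eq_Suc_le mult_le_cancel2 nat_mult_1 One_nat_def)
  then have "int a = gcd (int a) (int r * b)"
    using m(2) by (metis dvd_div_eq_mult gcd_dvd1 gcd_eq_0_iff mult_1 of_nat_1 of_nat_0_less_iff \<open>a > 0\<close> less_irrefl)
  then show ?thesis
    unfolding r_def by (metis gcd_dvd2)
qed

text \<open>For nonzero \<open>h\<close> the hypothesis says that \<open>h ^ d\<close> and
  \<open>f powi n\<close> have the same logarithmic derivative. Multiplying by \<open>h * f\<close>
  avoids lowered exponents.\<close>

lemma derivation_power_quotient_eq_0:
  fixes D :: "'a::field \<Rightarrow> 'a"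
  assumes D: "derivation D" and "f \<noteq> 0" and "d > 0"
    and h: "of_nat d * f * D h = of_int n * h * D f"
  shows "D (h ^ d / f powi n) = 0"
proof (cases "h = 0")
  case True
  then show ?thesis
    using derivation.zero[OF D] \<open>d > 0\<close> by (simp add: power_0_left)
next
  case False
  have "h * f * (D (h ^ d) * f powi n - h ^ d * D (f powi n))
      = (h * D (h powi int d)) * f * f powi n - h * h ^ d * (f * D (f powi n))"
    by (simp add: algebra_simps)
  also have "\<dots> = (of_nat d * f * D h - of_int n * h * D f) * h ^ d * f powi n"
    unfolding derivation_power_int[OF D \<open>f \<noteq> 0\<close>] derivation_power_int[OF D False]
    by (simp add: algebra_simps)
  also have "\<dots> = 0"
    by (simp add: h)
  finally show ?thesis
    using False \<open>f \<noteq> 0\<close> by (simp add: derivation_divide[OF D])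
qed


section \<open>Magnus' formula\<close>

lemma
  fixes P :: "'k::field_char_0 poly poly"
  assumes "P \<noteq> 0"
  shows hom_part_wdeg_neq_0: "hom_part w (wdeg w P) P \<noteq> 0"
    and wdeg_lead_form: "wdeg w (lead_form w P) = wdeg w P"
proof -
  have "supp P \<noteq> {}"
  proof
    assume "supp P = {}"
    then have "P = 0" by (intro poly2_eqI) (auto simp: supp_def)
    then show False using assms by simp
  qed
  then have "wdeg w P \<in> mon_deg w ` supp P"
    unfolding wdeg_def by (intro Max_in) (auto simp: finite_supp)
  then obtain m where m: "m \<in> supp P" "mon_deg w m = wdeg w P" by auto
  then have "coeff2 (hom_part w (wdeg w P) P) m \<noteq> 0"
    by (simp add: coeff2_hom_part supp_def)
  then show "hom_part w (wdeg w P) P \<noteq> 0" by auto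
  have "mon_deg w ` supp (lead_form w P) = {wdeg w P}"
    using m by (auto simp: lead_form_def supp_def coeff2_hom_part image_iff split: if_splits)
  then show "wdeg w (lead_form w P) = wdeg w P"
    by (simp add: wdeg_def[of w "lead_form w P"])
qed

lemma newton_polygon_le_wdeg:
  fixes x y :: real
  assumes "(x, y) \<in> newton_polygon P"
  shows "real_of_int (fst w) * x + real_of_int (snd w) * y \<le> wdeg w P"
proof -
  have "newton_polygon P \<subseteq> {p. inner (real_of_int (fst w), real_of_int (snd w)) p \<le> wdeg w P}"
    unfolding newton_polygon_def
  proof (rule hull_minimal)
    have "real_of_int (fst w) * real i + real_of_int (snd w) * real j \<le> real_of_int (wdeg w P)"
      if "(i, j) \<in> supp P" for i j
    proof -
      have "fst w * int i + snd w * int j \<le> wdeg w P"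
        using supp_mon_deg_le_wdeg[OF that, of w] by (simp add: mon_deg_def)
      then have "real_of_int (fst w * int i + snd w * int j) \<le> real_of_int (wdeg w P)"
        by (simp only: of_int_le_iff)
      then show ?thesis by simp
    qed
    then show "(\<lambda>(i, j). (real i, real j)) ` supp P
        \<subseteq> {p. inner (real_of_int (fst w), real_of_int (snd w)) p \<le> wdeg w P}"
      by auto
  qed (rule convex_halfspace_le)
  then show ?thesis
    using assms by auto
qed

text \<open>The points \<open>(1, 0)\<close> and \<open>(0, 1)\<close> bound the degree below by
  \<open>u\<close> and by \<open>v\<close>, one of which is positive.\<close>

lemma wdeg_pos:
  assumes "{(1, 0), (0, 1), (0, 0)} \<subseteq> newton_polygon P" "w \<in> directions"
  shows "wdeg w P > 0"
proof -
  have "real_of_int (fst w) \<le> wdeg w P" "real_of_int (snd w) \<le> wdeg w P"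
    using assms(1) newton_polygon_le_wdeg[of 1 0 P w] newton_polygon_le_wdeg[of 0 1 P w] by auto
  then show ?thesis
    using assms(2) by (auto simp: directions_def)
qed

lemma newton_polygon_0: "newton_polygon 0 = {}"
  by (simp add: newton_polygon_def supp_def)

text \<open>This triangular recursion produces the remainders \<open>h\<close> before the constants
  of the formula are known.\<close>

lemma convolution_solution_exists:
  fixes g :: "nat \<Rightarrow> 'a::comm_ring_1"
  shows "\<exists>h. \<forall>n. h n = g n - (\<Sum>k<n. h k * K k n)"
proof -
  define h where "h = wfrec less_than (\<lambda>h n. g n - (\<Sum>k<n. h k * K k n))"
  have "h n = g n - (\<Sum>k<n. h k * K k n)" for n
    unfolding h_def by (subst wfrec) (simp_all add: cut_apply)
  then show ?thesis by blast
qed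

lemma frac_const_of_int: "frac_const (of_int k) = (of_int k :: 'k::field poly poly fract)"
proof -
  interpret field_hom "frac_const :: 'k \<Rightarrow> _" by (rule field_hom_frac_const)
  show ?thesis by (rule hom_of_int)
qed

lemma frac_const_fact: "frac_const (fact n) = (fact n :: 'k::field_char_0 poly poly fract)"
proof -
  interpret field_hom "frac_const :: 'k \<Rightarrow> _" by (rule field_hom_frac_const)
  show ?thesis by (metis hom_of_nat of_nat_fact)
qed

lemma frac_const_gbinomial: "frac_const (a gchoose n) = frac_const (a :: 'k::field_char_0) gchoose n"
proof -
  interpret field_hom "frac_const :: 'k \<Rightarrow> _" by (rule field_hom_frac_const)
  show ?thesis by (simp add: gbinomial_prod_rev hom_distribs frac_const_fact)
qed

lemma emb_const2: "emb (const2 a) = to_ac (frac_const a)"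
  by (simp add: emb_def frac_const_def)

lemma to_ac_power_int: "to_ac (z powi n) = to_ac z powi n"
  by (simp add: power_int_def)

text \<open>With \<open>d\<close> the degree of \<open>F\<close> this is the series \<Phi>; with
  \<open>e\<close> and \<open>G\<close> it is \<Gamma>.\<close>

definition hom_fps :: "int \<times> int \<Rightarrow> int \<Rightarrow> 'k::field poly poly \<Rightarrow> 'k poly poly fract fps" where
  "hom_fps w d F = Abs_fps (\<lambda>n. to_fract (hom_part w (d - int n) F))"

lemma hom_fps_nth [simp]: "hom_fps w d F $ n = to_fract (hom_part w (d - int n) F)"
  by (simp add: hom_fps_def)

text \<open>The power \<open>n / d\<close> of \<Phi> divided by that of its constant term. Splitting
  off the fractional power of the leading form keeps the coefficients in
  \<open>K(x,y)\<close>.\<close>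

definition magnus_series :: "int \<times> int \<Rightarrow> 'k::field_char_0 poly poly \<Rightarrow> int \<Rightarrow> int \<Rightarrow> 'k poly poly fract fps" where
  "magnus_series w F d n = fps_binomial (of_int n / of_int d)
     oo (fps_const (inverse (hom_fps w d F $ 0)) * hom_fps w d F - 1)"

lemma magnus_series_nth_0 [simp]: "magnus_series w F d n $ 0 = 1"
  by (simp add: magnus_series_def)

text \<open>The multinomial sum is a coefficient of a binomial series composed with
  \<open>S\<close>. Writing each homogeneous part as a coefficient of \<open>S\<close> times the
  leading form uses \<open>N\<close> factors of the latter, which account for the shift
  \<open>d * N\<close> in the exponent of \<rho>.\<close>

lemma magnus_rhs_eq:
  fixes F :: "'k::field_char_0 poly poly"
  assumes "d > 0" and nz: "hom_part w d F \<noteq> 0" and \<rho>: "\<rho> ^ nat d = emb (hom_part w d F)"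
  shows "magnus_rhs w F d e \<rho> c (int \<mu>)
    = (\<Sum>\<gamma>\<le>\<mu>. to_ac (frac_const (c (int \<gamma>))) * \<rho> powi (e - int \<gamma>)
               * to_ac (magnus_series w F d (e - int \<gamma>) $ (\<mu> - \<gamma>)))"
proof -
  interpret c: field_hom "frac_const :: 'k \<Rightarrow> _" by (rule field_hom_frac_const)
  define f where "f = to_fract (hom_part w d F)"
  have f: "f \<noteq> 0" "to_ac f = \<rho> ^ nat d"
    using nz \<rho> by (simp_all add: f_def emb_def)
  have "\<rho> \<noteq> 0"
    using f \<open>d > 0\<close> by (metis to_ac_eq_0_iff power_0_left zero_less_nat_eq less_irrefl)
  define S where "S = fps_const (inverse (hom_fps w d F $ 0)) * hom_fps w d F - 1"
  have S0: "S $ 0 = 0"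
    using nz by (simp add: S_def)
  have S: "S $ nat (d - \<alpha>) = to_fract (hom_part w \<alpha> F) / f" if "\<alpha> \<le> d - 1" for \<alpha>
    using that by (simp add: S_def f_def field_simps)
  have inner: "(\<Sum>\<nu> \<in> families d (int n).
          let N = (\<Sum>\<alpha> | \<nu> \<alpha> \<noteq> 0. \<nu> \<alpha>) in
          emb (const2 (((of_int m / of_int d) gchoose N) *
                       (fact N / (\<Prod>\<alpha> | \<nu> \<alpha> \<noteq> 0. fact (\<nu> \<alpha>))))) *
          \<rho> powi (m - d * int N) *
          (\<Prod>\<alpha> | \<nu> \<alpha> \<noteq> 0. emb (hom_part w \<alpha> F) ^ \<nu> \<alpha>))
      = \<rho> powi m * to_ac (magnus_series w F d m $ n)" for n m
  proof -
    have summand: "emb (const2 (((of_int m / of_int d) gchoose N) * (fact N / (\<Prod>\<alpha> | \<nu> \<alpha> \<noteq> 0. fact (\<nu> \<alpha>)))))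
          * \<rho> powi (m - d * int N) * (\<Prod>\<alpha> | \<nu> \<alpha> \<noteq> 0. emb (hom_part w \<alpha> F) ^ \<nu> \<alpha>)
        = \<rho> powi m * to_ac (fps_binomial (of_int m / of_int d) $ N
             * (fact N / (\<Prod>\<alpha> | \<nu> \<alpha> \<noteq> 0. fact (\<nu> \<alpha>))) * (\<Prod>\<alpha> | \<nu> \<alpha> \<noteq> 0. (S $ nat (d - \<alpha>)) ^ \<nu> \<alpha>))"
      if \<nu>: "\<nu> \<in> families d (int n)" and N: "N = (\<Sum>\<alpha> | \<nu> \<alpha> \<noteq> 0. \<nu> \<alpha>)" for \<nu> N
    proof -
      have coeff: "frac_const (((of_int m / of_int d :: 'k) gchoose N) * (fact N / (\<Prod>\<alpha> | \<nu> \<alpha> \<noteq> 0. fact (\<nu> \<alpha>))))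
          = fps_binomial (of_int m / of_int d) $ N * (fact N / (\<Prod>\<alpha> | \<nu> \<alpha> \<noteq> 0. fact (\<nu> \<alpha>)))"
        by (simp add: hom_distribs frac_const_gbinomial frac_const_fact frac_const_of_int)
      have "(\<Prod>\<alpha> | \<nu> \<alpha> \<noteq> 0. (S $ nat (d - \<alpha>)) ^ \<nu> \<alpha>)
          = (\<Prod>\<alpha> | \<nu> \<alpha> \<noteq> 0. to_fract (hom_part w \<alpha> F) ^ \<nu> \<alpha> / f ^ \<nu> \<alpha>)"
        using \<nu> S by (intro prod.cong) (auto simp: families_def power_divide)
      also have "\<dots> = (\<Prod>\<alpha> | \<nu> \<alpha> \<noteq> 0. to_fract (hom_part w \<alpha> F) ^ \<nu> \<alpha>) / f ^ N"
        by (simp add: prod_dividef N power_sum)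
      finally have "to_ac (\<Prod>\<alpha> | \<nu> \<alpha> \<noteq> 0. (S $ nat (d - \<alpha>)) ^ \<nu> \<alpha>)
          = (\<Prod>\<alpha> | \<nu> \<alpha> \<noteq> 0. emb (hom_part w \<alpha> F) ^ \<nu> \<alpha>) / (\<rho> ^ nat d) ^ N"
        by (simp add: to_ac_prod emb_def f(2))
      moreover have "\<rho> powi (m - d * int N) = \<rho> powi m / (\<rho> ^ nat d) ^ N"
        using \<open>\<rho> \<noteq> 0\<close> \<open>d > 0\<close> by (simp add: power_int_diff power_int_mult) (simp add: power_int_def)
      ultimately show ?thesis
        unfolding emb_const2 coeff to_ac_mult by simp
    qed
    show ?thesis
      unfolding magnus_series_def S_def[symmetric] fps_compose_nth_families[OF S0, of _ n d] to_ac_sum sum_distrib_left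
      by (rule sum.cong[OF refl]) (simp only: Let_def summand)
  qed
  have "magnus_rhs w F d e \<rho> c (int \<mu>)
      = (\<Sum>\<gamma>=0..int \<mu>. to_ac (frac_const (c \<gamma>)) * \<rho> powi (e - \<gamma>)
               * to_ac (magnus_series w F d (e - \<gamma>) $ nat (int \<mu> - \<gamma>)))"
    unfolding magnus_rhs_def
  proof (rule sum.cong[OF refl])
    fix \<gamma> assume "\<gamma> \<in> {0..int \<mu>}"
    then have "int \<mu> - \<gamma> = int (nat (int \<mu> - \<gamma>))" by simp
    then show "emb (const2 (c \<gamma>)) *
       (\<Sum>\<nu> \<in> families d (int \<mu> - \<gamma>).
          let N = (\<Sum>\<alpha> | \<nu> \<alpha> \<noteq> 0. \<nu> \<alpha>) in
          emb (const2 (((of_int (e - \<gamma>) / of_int d) gchoose N) *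
                       (fact N / (\<Prod>\<alpha> | \<nu> \<alpha> \<noteq> 0. fact (\<nu> \<alpha>))))) *
          \<rho> powi (e - \<gamma> - d * int N) *
          (\<Prod>\<alpha> | \<nu> \<alpha> \<noteq> 0. emb (hom_part w \<alpha> F) ^ \<nu> \<alpha>))
       = to_ac (frac_const (c \<gamma>)) * \<rho> powi (e - \<gamma>)
               * to_ac (magnus_series w F d (e - \<gamma>) $ nat (int \<mu> - \<gamma>))"
      using inner[where n = "nat (int \<mu> - \<gamma>)" and m = "e - \<gamma>"] by (simp only: emb_const2 mult.assoc)
  qed
  also have "\<dots> = (\<Sum>\<gamma>\<le>\<mu>. to_ac (frac_const (c (int \<gamma>))) * \<rho> powi (e - int \<gamma>)
               * to_ac (magnus_series w F d (e - int \<gamma>) $ (\<mu> - \<gamma>)))"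
    by (rule sum.reindex_bij_witness[of _ int nat]) (auto simp: nat_diff_distrib)
  finally show ?thesis .
qed

text \<open>By \<open>magnus_coefficients\<close>, the power \<open>d\<close> of
  \<open>h \<mu>\<close> is a constant times the power \<open>e - \<mu>\<close> of the leading form;
  extracting a root in the algebraic closure expresses \<open>h \<mu>\<close> through
  \<rho>.\<close>

lemma magnus_expansion_exists:
  fixes F G :: "'k::{alg_closed_field, field_char_0} poly poly"
  assumes const: "jacobian F G \<in> range const2"
    and d: "d = wdeg w F" "d > 0" and e: "e = wdeg w G"
    and M: "int M < d + e - fst w - snd w"
    and nz: "hom_part w d F \<noteq> 0" and \<rho>: "\<rho> ^ nat d = emb (hom_part w d F)"
  obtains c h where
    "\<And>\<mu>. \<mu> \<le> M \<Longrightarrow> to_ac (h \<mu>) = to_ac (frac_const (c \<mu>)) * \<rho> powi (e - int \<mu>)"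
    and "\<And>\<mu>. to_fract (hom_part w (e - int \<mu>) G)
           = (\<Sum>\<gamma>\<le>\<mu>. h \<gamma> * magnus_series w F d (e - int \<gamma>) $ (\<mu> - \<gamma>))"
proof -
  define \<Phi> \<Gamma> where "\<Phi> = hom_fps w d F" and "\<Gamma> = hom_fps w e G"
  define Dx Dy :: "'k poly poly fract \<Rightarrow> 'k poly poly fract"
    where "Dx = fract_deriv deriv_x" and "Dy = fract_deriv deriv_y"
  define a b :: "'k poly poly fract"
    where "a = of_int (fst w) * to_fract [:[:0, 1:]:]" and "b = of_int (snd w) * to_fract [:0, 1:]"
  define E where "E = (\<lambda>z. a * Dx z + b * Dy z)"
  have derivs: "derivation Dx" "derivation Dy"
    unfolding Dx_def Dy_def
    by (intro derivation_fract_deriv derivation_deriv_x derivation_deriv_y)+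
  have Dx: "Dx (to_fract P) = to_fract (deriv_x P)" and Dy: "Dy (to_fract P) = to_fract (deriv_y P)" for P
    unfolding Dx_def Dy_def
    by (intro fract_deriv_to_fract derivation_deriv_x derivation_deriv_y)+
  have of_int: "of_int k = to_fract (of_int k :: 'k poly poly)" for k
    using frac_const_of_int[of k, symmetric] by (simp add: frac_const_def const2_of_int)
  have E: "E (to_fract P) = to_fract (euler w P)" for P
    unfolding E_def a_def b_def Dx Dy euler_def of_int by (simp only: to_fract_add to_fract_mult)
  have Ehom: "E (to_fract (hom_part w n P)) = of_int n * to_fract (hom_part w n P)" for n P
    by (simp add: E euler_hom_part of_int)
  obtain h where h: "h n = \<Gamma> $ n - (\<Sum>\<gamma><n. h \<gamma> * magnus_series w F d (e - int \<gamma>) $ (n - \<gamma>))" for n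
    using convolution_solution_exists[of "fps_nth \<Gamma>" "\<lambda>\<gamma> n. magnus_series w F d (e - int \<gamma>) $ (n - \<gamma>)"]
    by blast
  have \<Phi>0: "\<Phi> $ 0 = to_fract (hom_part w d F)"
    by (simp add: \<Phi>_def)
  have jac: "(fps_coeffwise Dx \<Phi> * fps_coeffwise Dy \<Gamma>) $ k
           = (fps_coeffwise Dx \<Gamma> * fps_coeffwise Dy \<Phi>) $ k" if "k \<le> M" for k
  proof -
    let ?F = "\<lambda>i. hom_part w (d - int i) F" and ?G = "\<lambda>i. hom_part w (e - int i) G"
    have "(fps_coeffwise Dx \<Phi> * fps_coeffwise Dy \<Gamma>) $ k - (fps_coeffwise Dy \<Phi> * fps_coeffwise Dx \<Gamma>) $ k
        = (\<Sum>i\<le>k. to_fract (jacobian (?F i) (?G (k - i))))"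
      unfolding fps_mult_nth sum_subtractf[symmetric] atMost_atLeast0
      by (simp add: \<Phi>_def \<Gamma>_def Dx Dy jacobian_def mult.commute)
    also have "\<dots> = to_fract (\<Sum>i\<le>k. jacobian (?F i) (?G (k - i)))"
      by (induction k) simp_all
    \<comment> \<open>For \<open>k \<le> M\<close> the degree \<open>d + e - u - v - k\<close> is
      positive, so this part of the constant Jacobian vanishes.\<close>
    also have "(\<Sum>i\<le>k. jacobian (?F i) (?G (k - i))) = 0"
      using that M by (intro sum_jacobian_hom_parts_eq_0[OF const d(1) e]) simp
    finally show ?thesis
      by (simp add: mult.commute)
  qed
  have E_eq: "E z = a * Dx z + b * Dy z" for z
    by (simp add: E_def)
  have E\<Phi>: "E (\<Phi> $ k) = of_int (d - int k) * \<Phi> $ k"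
    and E\<Gamma>: "E (\<Gamma> $ k) = of_int (e - int k) * \<Gamma> $ k" for k
    unfolding \<Phi>_def \<Gamma>_def hom_fps_nth by (rule Ehom)+
  have h': "h n = \<Gamma> $ n - (\<Sum>\<gamma><n. h \<gamma> * (fps_binomial (of_int (e - int \<gamma>) / of_int d)
      oo (fps_const (inverse (\<Phi> $ 0)) * \<Phi> - 1)) $ (n - \<gamma>))" for n
    using h[of n] unfolding magnus_series_def \<Phi>_def .
  have "\<exists>c. to_ac (h \<mu>) = to_ac (frac_const c) * \<rho> powi (e - int \<mu>)" if "\<mu> \<le> M" for \<mu>
  proof -
    define f where "f = to_fract (hom_part w d F)"
    have f: "f \<noteq> 0" "to_ac f = \<rho> ^ nat d"
      using nz \<rho> by (simp_all add: f_def emb_def)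
    have \<rho>0: "\<rho> \<noteq> 0"
      using f \<open>d > 0\<close> by (metis to_ac_eq_0_iff power_0_left zero_less_nat_eq less_irrefl)
    let ?n = "e - int \<mu>" and ?d = "nat d"
    have "of_int d * f * Dx (h \<mu>) = of_int ?n * h \<mu> * Dx f" "of_int d * f * Dy (h \<mu>) = of_int ?n * h \<mu> * Dy f"
      using magnus_coefficients[OF derivs E_eq _ _ E\<Phi> E\<Gamma> jac h' that] nz \<open>d > 0\<close>
      unfolding \<Phi>0 f_def by simp_all
    moreover have "(of_int d :: 'k poly poly fract) = of_nat ?d" "?d > 0"
      using \<open>d > 0\<close> by (simp_all add: of_nat_nat)
    ultimately have ld: "of_nat ?d * f * Dx (h \<mu>) = of_int ?n * h \<mu> * Dx f"
        "of_nat ?d * f * Dy (h \<mu>) = of_int ?n * h \<mu> * Dy f" "?d > 0"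
      by (simp_all only:)
    have "Dx (h \<mu> ^ ?d / f powi ?n) = 0" "Dy (h \<mu> ^ ?d / f powi ?n) = 0"
      by (rule derivation_power_quotient_eq_0[OF _ f(1) ld(3)]; intro derivs ld)+
    then obtain \<kappa> where \<kappa>: "h \<mu> ^ ?d / f powi ?n = frac_const \<kappa>"
      unfolding Dx_def Dy_def frac_const_def by (rule fract_deriv_eq_0_imp_const)
    have "field_hom (to_ac \<circ> (frac_const :: 'k \<Rightarrow> _))"
    proof -
      interpret field_hom "frac_const :: 'k \<Rightarrow> _" by (rule field_hom_frac_const)
      show ?thesis
        by unfold_locales (simp_all add: hom_distribs)
    qed
    moreover have "(to_ac (h \<mu>) / \<rho> powi ?n) ^ ?d = (to_ac \<circ> frac_const) \<kappa>"
    proof -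
      have "(\<rho> powi ?n) ^ ?d = to_ac (f powi ?n)"
        by (simp only: to_ac_power_int f(2) power_int_power power_int_power' mult.commute)
      then show ?thesis
        by (simp add: \<kappa>[symmetric] power_divide)
    qed
    \<comment> \<open>A \<open>d\<close>-th root of a constant in the algebraic closure is again a
      constant from \<open>K\<close>.\<close>
    ultimately have "to_ac (h \<mu>) / \<rho> powi ?n \<in> range (to_ac \<circ> (frac_const :: 'k \<Rightarrow> _))"
      using \<open>d > 0\<close> by (intro alg_closed_root_in_range[of _ _ ?d]) auto
    then show ?thesis
      using \<rho>0 by (auto simp: field_simps)
  qed
  then obtain c where c: "\<And>\<mu>. \<mu> \<le> M \<Longrightarrow> to_ac (h \<mu>) = to_ac (frac_const (c \<mu>)) * \<rho> powi (e - int \<mu>)"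
    by metis
  have "to_fract (hom_part w (e - int \<mu>) G)
      = (\<Sum>\<gamma>\<le>\<mu>. h \<gamma> * magnus_series w F d (e - int \<gamma>) $ (\<mu> - \<gamma>))" for \<mu>
    using h[of \<mu>] by (simp add: \<Gamma>_def flip: lessThan_Suc_atMost)
  with c that show ?thesis by blast
qed

theorem theorem1p1:
  fixes F G :: "'k::{alg_closed_field, field_char_0} poly poly"
    and u v d e :: int
    and w :: "int \<times> int"
    and \<rho> :: "'k poly poly fract alg_closure"
  assumes "jacobian F G \<in> range const2"
    and "{(1, 0), (0, 1), (0, 0)} \<subseteq> newton_polygon F \<inter> newton_polygon G"
    and "w = (u, v)" and "w \<in> directions"
    and "d = wdeg w (lead_form w F)" and "e = wdeg w (lead_form w G)"
    and "d + e - u - v - 1 \<ge> 0"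
    and "\<rho> ^ nat d = emb (hom_part w d F)"
  shows "(\<exists>!c. c \<in> {0..d + e - u - v - 1} \<rightarrow>\<^sub>E UNIV \<and> c 0 \<noteq> 0 \<and>
               (\<forall>\<mu> \<in> {0..d + e - u - v - 1}.
                  emb (hom_part w (e - \<mu>) G) = magnus_rhs w F d e \<rho> c \<mu>)) \<and>
         (\<forall>c. c \<in> {0..d + e - u - v - 1} \<rightarrow>\<^sub>E UNIV \<and> c 0 \<noteq> 0 \<and>
              (\<forall>\<mu> \<in> {0..d + e - u - v - 1}.
                  emb (hom_part w (e - \<mu>) G) = magnus_rhs w F d e \<rho> c \<mu>) \<longrightarrow>
              (\<forall>\<gamma> \<in> {0..d + e - u - v - 1}.
                  of_nat (max_power_exponent (hom_part w d F)) * of_int (e - \<gamma>) / of_int d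
                    \<notin> (\<int> :: rat set) \<longrightarrow> c \<gamma> = 0))"
proof -
  interpret c: field_hom "frac_const :: 'k \<Rightarrow> _" by (rule field_hom_frac_const)
  let ?I = "{0..d + e - u - v - 1}"
  define M where "M = nat (d + e - u - v - 1)"
  have I: "\<mu> \<in> ?I \<longleftrightarrow> (\<exists>n\<le>M. \<mu> = int n)" for \<mu>
    using assms(7) by (auto simp: M_def intro!: exI[of _ "nat \<mu>"])
  have FG: "F \<noteq> 0" "G \<noteq> 0"
    using assms(2) by (auto simp: newton_polygon_0)
  have d: "d = wdeg w F" and e: "e = wdeg w G"
    using assms(5,6) FG by (simp_all add: wdeg_lead_form)
  have "d > 0"
    using wdeg_pos[of F w] assms(2,4) unfolding d by blast
  have nzF: "hom_part w d F \<noteq> 0" and nzG: "hom_part w e G \<noteq> 0"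
    using FG by (simp_all add: d e hom_part_wdeg_neq_0)
  note rhs = magnus_rhs_eq[OF \<open>d > 0\<close> nzF assms(8)]
  define f where "f = to_fract (hom_part w d F)"
  have f: "f \<noteq> 0" "to_ac f = \<rho> ^ nat d"
    using nzF assms(8) by (simp_all add: f_def emb_def)
  have \<rho>0: "\<rho> \<noteq> 0"
    using f \<open>d > 0\<close> by (metis to_ac_eq_0_iff power_0_left zero_less_nat_eq less_irrefl)
  have M: "int M < d + e - fst w - snd w"
    using assms(3,7) by (simp add: M_def)
  obtain c h where
    h: "\<And>\<mu>. \<mu> \<le> M \<Longrightarrow> to_ac (h \<mu>) = to_ac (frac_const (c \<mu>)) * \<rho> powi (e - int \<mu>)"
    and G: "\<And>\<mu>. to_fract (hom_part w (e - int \<mu>) G)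
           = (\<Sum>\<gamma>\<le>\<mu>. h \<gamma> * magnus_series w F d (e - int \<gamma>) $ (\<mu> - \<gamma>))"
    by (rule magnus_expansion_exists[OF assms(1) d \<open>d > 0\<close> e M nzF assms(8)]) (rule that)
  \<comment> \<open>The sequences are extensional functions on \<open>?I\<close>; restriction fixes
    the values outside, so that uniqueness only concerns indices in \<open>?I\<close>.\<close>
  define c0 where "c0 = (\<lambda>\<gamma>\<in>?I. c (nat \<gamma>))"
  have c0: "c0 (int n) = c n" if "n \<le> M" for n
    using that I[of "int n"] by (auto simp: c0_def)
  define sol where "sol = (\<lambda>c. \<forall>\<mu>\<in>?I. emb (hom_part w (e - \<mu>) G) = magnus_rhs w F d e \<rho> c \<mu>)"
  have sol_c0: "sol c0"
    unfolding sol_def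
  proof
    fix \<mu> assume "\<mu> \<in> ?I"
    then obtain n where n: "n \<le> M" "\<mu> = int n"
      unfolding I by blast
    then show "emb (hom_part w (e - \<mu>) G) = magnus_rhs w F d e \<rho> c0 \<mu>"
      by (simp add: rhs emb_def G to_ac_sum h c0)
  qed
  \<comment> \<open>At order 0 the expansion reduces to \<open>h 0\<close>, which equals the leading
    form of \<open>G\<close>.\<close>
  have c0_0: "c0 0 \<noteq> 0"
  proof
    assume "c0 0 = 0"
    then have "to_ac (h 0) = 0"
      using h[of 0] c0[of 0] by simp
    then show False
      using G[of 0] nzG by simp
  qed
  \<comment> \<open>The system is triangular: at order \<open>n\<close> the new unknown at
    \<open>int n\<close> has the nonzero coefficient \<open>\<rho> powi (e - int n)\<close>.\<close>
  have uniq: "c1 = c2" if c1: "c1 \<in> ?I \<rightarrow>\<^sub>E UNIV" "sol c1" and c2: "c2 \<in> ?I \<rightarrow>\<^sub>E UNIV" "sol c2" for c1 c2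
  proof (rule PiE_ext[OF c1(1) c2(1)])
    have "c1 (int n) = c2 (int n)" if "n \<le> M" for n
      using that
    proof (induction n rule: less_induct)
      case (less n)
      have "magnus_rhs w F d e \<rho> c1 (int n) = magnus_rhs w F d e \<rho> c2 (int n)"
        using c1(2) c2(2) I[of "int n"] less.prems unfolding sol_def by (metis le_refl)
      then show ?case
        using less \<rho>0 by (simp add: rhs flip: lessThan_Suc_atMost)
    qed
    then show "c1 \<mu> = c2 \<mu>" if "\<mu> \<in> ?I" for \<mu>
      using iffD1[OF I that] by auto
  qed
  have vanish: "c0 \<gamma> = 0" if \<gamma>: "\<gamma> \<in> ?I"
    and non_int: "of_nat (max_power_exponent (hom_part w d F)) * of_int (e - \<gamma>) / of_int d \<notin> (\<int> :: rat set)" for \<gamma>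
  proof (rule ccontr)
    assume nz: "c0 \<gamma> \<noteq> 0"
    obtain n where n: "n \<le> M" "\<gamma> = int n"
      using \<gamma> unfolding I by blast
    \<comment> \<open>Dividing \<open>h n\<close> by its nonzero constant puts the power
      \<open>e - \<gamma>\<close> of \<rho> into \<open>K(x,y)\<close>; hence the same power of the
      leading form is a \<open>d\<close>-th power there.\<close>
    define k where "k = h n / frac_const (c n)"
    have "to_ac k = \<rho> powi (e - \<gamma>)"
      using nz n c0[of n] by (simp add: k_def h)
    then have "to_ac (k ^ nat d) = to_ac (f powi (e - \<gamma>))"
      by (simp only: to_ac_power to_ac_power_int f(2) power_int_power power_int_power' mult.commute)
    then have "k ^ nat d = to_fract (hom_part w d F) powi (e - \<gamma>)"
      by (simp only: to_ac_eq_iff f_def)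
    moreover have "hom_part w d F \<notin> range const2"
    proof
      assume "hom_part w d F \<in> range const2"
      then obtain a where a: "hom_part w d F = const2 a" by blast
      then have "coeff2 (hom_part w d F) (0, 0) \<noteq> 0"
        using nzF by (auto simp: coeff2_const2)
      then show False
        using \<open>d > 0\<close> by (simp add: coeff2_hom_part mon_deg_def split: if_splits)
    qed
    ultimately have "int (nat d) dvd int (max_power_exponent (hom_part w d F)) * (e - \<gamma>)"
      using \<open>d > 0\<close> by (intro max_power_exponent_dvd) auto
    then obtain t where t: "int (max_power_exponent (hom_part w d F)) * (e - \<gamma>) = d * t"
      using \<open>d > 0\<close> by (auto elim: dvdE)
    have "of_nat (max_power_exponent (hom_part w d F)) * of_int (e - \<gamma>) = (of_int d * of_int t :: rat)"
      using arg_cong[OF t, of "of_int :: int \<Rightarrow> rat"] by simp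
    then show False
      using non_int \<open>d > 0\<close> by simp
  qed
  have ext: "c0 \<in> ?I \<rightarrow>\<^sub>E UNIV"
    by (simp add: c0_def)
  have "\<exists>!c. c \<in> ?I \<rightarrow>\<^sub>E UNIV \<and> c 0 \<noteq> 0 \<and> sol c"
    using ext c0_0 sol_c0 uniq by (intro ex1I[of _ c0]) simp_all
  moreover have "\<forall>c. c \<in> ?I \<rightarrow>\<^sub>E UNIV \<and> c 0 \<noteq> 0 \<and> sol c \<longrightarrow>
      (\<forall>\<gamma>\<in>?I. of_nat (max_power_exponent (hom_part w d F)) * of_int (e - \<gamma>) / of_int d
         \<notin> (\<int> :: rat set) \<longrightarrow> c \<gamma> = 0)"
  proof (intro allI impI ballI)
    fix c \<gamma>
    assume "c \<in> ?I \<rightarrow>\<^sub>E UNIV \<and> c 0 \<noteq> 0 \<and> sol c"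
    then have "c = c0"
      using ext sol_c0 by (intro uniq) auto
    then show "c \<gamma> = 0" if "\<gamma> \<in> ?I" and "of_nat (max_power_exponent (hom_part w d F)) * of_int (e - \<gamma>) / of_int d
         \<notin> (\<int> :: rat set)"
      using vanish[OF that] by simp
  qed
  ultimately show ?thesis
    unfolding sol_def by (rule conjI)
qed

end
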